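(* For every integer $\ell\ge 16$, \[\tilde{r}(P_3,P_3,C_\ell)=\begin{cases}(3\ell+1)/2, & \text{if } \ell \equiv 3\pmod{4}; \\ \left\lfloor 3(\ell+1)/2 \right\rfloor, & \text{otherwise}. \end{cases}\]
   Context: $P_m$ denotes the path on $m$ vertices and $C_m$ the cycle on $m$ vertices. The three-color online Ramsey game for graphs $G_1,G_2,G_3$ is played by Builder and Painter on an infinite vertex set with initially no edges. In each round Builder draws an edge between two currently nonadjacent vertices, and Painter immediately colors it with one of the colors red, blue, green. Builder wins once the colored graph contains a red copy of $G_1$, a blue copy of $G_2$, or a green copy of $G_3$ (as a subgraph). The online Ramsey number $\tilde{r}(G_1,G_2,G_3)$ is the minimum number of rounds within which Builder can guarantee a win against every strategy of Painter. *)

theory Defs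
  imports Main "HOL-Library.Extended_Nat"
begin

text \<open>A graph is a pair of a vertex set and a set of edges, each edge being a two-element set.\<close>

type_synonym 'a graph = "'a set \<times> 'a set set"

definition path_graph :: "nat \<Rightarrow> nat graph" where
  "path_graph m = ({..<m}, {{i, Suc i} | i. Suc i < m})"

text \<open>This is the cycle only for \<open>m \<ge> 3\<close>.\<close>

definition cycle_graph :: "nat \<Rightarrow> nat graph" where
  "cycle_graph m = ({..<m}, {{i, Suc i mod m} | i. i < m})"

text \<open>Copies are subgraphs, not necessarily induced ones.\<close>

definition contains_copy :: "'v graph \<Rightarrow> 'a graph \<Rightarrow> bool" where
  "contains_copy H G \<longleftrightarrow>
    (\<exists>f. inj_on f (fst G) \<and> f ` fst G \<subseteq> fst H \<and> (\<forall>e \<in> snd G. f ` e \<in> snd H))"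

datatype color = Red | Blue | Green

text \<open>The edges drawn so far with their colors, in chronological order.\<close>

type_synonym 'v history = "('v set \<times> color) list"

definition color_graph :: "'v set \<Rightarrow> 'v history \<Rightarrow> color \<Rightarrow> 'v graph" where
  "color_graph V h c = (V, {e. (e, c) \<in> set h})"

definition legal_move :: "'v set \<Rightarrow> 'v history \<Rightarrow> 'v set \<Rightarrow> bool" where
  "legal_move V h e \<longleftrightarrow> e \<subseteq> V \<and> card e = 2 \<and> e \<notin> fst ` set h"

text \<open>On an infinite board every history admits a legal move, so demanding legality on all
  histories, including those that the strategy never reaches, does not restrict Builder.\<close>

definition builder_strategy :: "'v set \<Rightarrow> ('v history \<Rightarrow> 'v set) \<Rightarrow> bool" where
  "builder_strategy V \<sigma> \<longleftrightarrow> (\<forall>h. legal_move V h (\<sigma> h))"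

text \<open>A Painter strategy \<open>\<pi>\<close> maps the history and the edge just drawn to a color.\<close>

primrec play :: "('v history \<Rightarrow> 'v set) \<Rightarrow> ('v history \<Rightarrow> 'v set \<Rightarrow> color) \<Rightarrow> nat \<Rightarrow> 'v history" where
  "play \<sigma> \<pi> 0 = []"
| "play \<sigma> \<pi> (Suc k) = (let h = play \<sigma> \<pi> k; e = \<sigma> h in h @ [(e, \<pi> h e)])"

definition builder_won :: "'v set \<Rightarrow> 'a graph \<Rightarrow> 'b graph \<Rightarrow> 'c graph \<Rightarrow> 'v history \<Rightarrow> bool" where
  "builder_won V G1 G2 G3 h \<longleftrightarrow>
    contains_copy (color_graph V h Red) G1 \<or>
    contains_copy (color_graph V h Blue) G2 \<or>
    contains_copy (color_graph V h Green) G3"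

definition builder_wins_within :: "'v set \<Rightarrow> 'a graph \<Rightarrow> 'b graph \<Rightarrow> 'c graph \<Rightarrow> nat \<Rightarrow> bool" where
  "builder_wins_within V G1 G2 G3 n \<longleftrightarrow>
    (\<exists>\<sigma>. builder_strategy V \<sigma> \<and> (\<forall>\<pi>. \<exists>k\<le>n. builder_won V G1 G2 G3 (play \<sigma> \<pi> k)))"

text \<open>The value is \<open>\<infinity>\<close> if Builder cannot guarantee a win within any fixed number of rounds.\<close>

definition online_ramsey :: "'v set \<Rightarrow> 'a graph \<Rightarrow> 'b graph \<Rightarrow> 'c graph \<Rightarrow> enat" where
  "online_ramsey V G1 G2 G3 = (INF n \<in> {n. builder_wins_within V G1 G2 G3 n}. enat n)"

end

theory Submission
  imports Defs "HOL-Library.Disjoint_Sets"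
begin

text \<open>Lower bound: Painter uses red if possible, else blue if possible, else green. Every edge of a
  green cycle then meets a red and a blue edge, so there are at least \<open>l / 4\<close> edges of either color.
  This leaves one round missing if 4 divides \<open>l\<close>; in that case Painter also refuses to close
  red-blue cycles.

  Upper bound: all further edges at a vertex that meets a red and a blue edge are forced to be
  green. Builder maintains one green path and at most two vertices off the path that meet a red or
  blue edge, and needs about three rounds for two further path edges, the exact surplus depending on
  what is known about the ends of the path. Finite decision trees turn every such position into one
  with a longer path or into a green cycle of the right length. They were found by a computer search
  that minimizes the surplus.\<close>

section \<open>Color classes\<close>

definition color_class :: "'v history \<Rightarrow> color \<Rightarrow> 'v set set" where
  "color_class h c = {e. (e, c) \<in> set h}"

definition touched :: "'v history \<Rightarrow> color \<Rightarrow> 'v set" where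
  "touched h c = \<Union> (color_class h c)"

definition edges_in :: "'v set \<Rightarrow> 'v history \<Rightarrow> bool" where
  "edges_in V h \<longleftrightarrow> (\<forall>e \<in> fst ` set h. e \<subseteq> V \<and> card e = 2)"

definition cycle_in :: "'v set set \<Rightarrow> nat \<Rightarrow> (nat \<Rightarrow> 'v) \<Rightarrow> bool" where
  "cycle_in E l f \<longleftrightarrow> inj_on f {..<l} \<and> (\<forall>i<l. {f i, f (Suc i mod l)} \<in> E)"

lemma color_class_Nil [simp]: "color_class [] c = {}"
  by (simp add: color_class_def)

lemma color_class_snoc:
  "color_class (h @ [(e, c)]) c' =
    (if c' = c then insert e (color_class h c') else color_class h c')"
  by (auto simp: color_class_def)

lemma touched_snoc:
  "touched (h @ [(e, c)]) c' = (if c' = c then e \<union> touched h c' else touched h c')"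
  by (simp add: touched_def color_class_snoc)

lemma touched_append: "touched h c \<subseteq> touched (h @ h') c"
  by (auto simp: touched_def color_class_def)

lemma finite_color_class [simp]: "finite (color_class h c)"
proof (rule finite_subset)
  show "color_class h c \<subseteq> fst ` set h" by (force simp: color_class_def)
qed simp

lemma edge_notin_color_class: "e \<notin> fst ` set h \<Longrightarrow> e \<notin> color_class h c"
  by (force simp: color_class_def)

lemma edges_in_Nil [simp]: "edges_in V []"
  by (simp add: edges_in_def)

lemma edges_in_snoc: "edges_in V h \<Longrightarrow> legal_move V h e \<Longrightarrow> edges_in V (h @ [(e, c)])"
  by (auto simp: edges_in_def legal_move_def)

lemma edges_in_color_class:
  assumes "edges_in V h" "e \<in> color_class h c"
  shows "e \<subseteq> V" "card e = 2"
  using assms by (force simp: edges_in_def color_class_def)+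

lemma finite_vertices:
  assumes "edges_in V h"
  shows "finite (\<Union> (fst ` set h))"
proof (rule finite_Union)
  show "finite e" if "e \<in> fst ` set h" for e
    using assms that unfolding edges_in_def by (metis card.infinite zero_neq_numeral)
qed simp

lemma finite_touched: "edges_in V h \<Longrightarrow> finite (touched h c)"
  by (rule finite_subset[OF _ finite_vertices]) (force simp: touched_def color_class_def)

lemma card_touched:
  assumes "edges_in V h" "disjoint (color_class h c)"
  shows "card (touched h c) = 2 * card (color_class h c)"
  using assms finite_touched[OF assms(1)] unfolding touched_def disjoint_def
  by (intro card_partition[symmetric]) (auto intro: edges_in_color_class)

lemma path_graph_3: "path_graph 3 = ({0, 1, 2}, {{0, 1}, {1, 2}})"
proof -
  have "{{i, Suc i} |i. Suc i < 3} = (\<lambda>i. {i, Suc i}) ` {..<2}" by auto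
  then show ?thesis by (auto simp: path_graph_def numeral_2_eq_2 numeral_3_eq_3 lessThan_Suc)
qed

lemma contains_path3_iff:
  assumes "edges_in V h"
  shows "contains_copy (color_graph V h c) (path_graph 3) \<longleftrightarrow> \<not> disjoint (color_class h c)"
proof
  assume "contains_copy (color_graph V h c) (path_graph 3)"
  then obtain f :: "nat \<Rightarrow> 'a" where f: "inj_on f {0, 1, 2}"
    and edges: "{f 0, f 1} \<in> color_class h c" "{f 1, f 2} \<in> color_class h c"
    by (auto simp: contains_copy_def path_graph_3 color_graph_def color_class_def)
  have "f 0 \<noteq> f 1" "f 0 \<noteq> f 2" using inj_onD[OF f, of 0 1] inj_onD[OF f, of 0 2] by auto
  then have neq: "{f 0, f 1} \<noteq> {f 1, f 2}" by (auto simp: doubleton_eq_iff)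
  show "\<not> disjoint (color_class h c)"
    using pairwiseD[OF _ edges neq, of disjnt] by (auto simp: disjnt_def)
next
  assume "\<not> disjoint (color_class h c)"
  then obtain x e e' where e: "e \<in> color_class h c" "x \<in> e"
    and e': "e' \<in> color_class h c" "x \<in> e'" and "e \<noteq> e'"
    by (auto simp: disjoint_def)
  obtain u where u: "e = {x, u}" "u \<noteq> x"
    using e edges_in_color_class(2)[OF assms e(1)] by (auto simp: card_2_iff)
  obtain w where w: "e' = {x, w}" "w \<noteq> x"
    using e' edges_in_color_class(2)[OF assms e'(1)] by (auto simp: card_2_iff)
  have "u \<noteq> w" using u w \<open>e \<noteq> e'\<close> by auto
  moreover note edges_in_color_class(1)[OF assms e(1)] edges_in_color_class(1)[OF assms e'(1)]
  ultimately show "contains_copy (color_graph V h c) (path_graph 3)"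
    using u w e(1) e'(1) unfolding contains_copy_def path_graph_3 color_graph_def color_class_def
    by (intro exI[of _ "(!) [u, x, w]"]) (simp add: inj_on_def insert_commute numeral_2_eq_2)
qed

lemma contains_cycle_iff:
  assumes "edges_in V h"
  shows "contains_copy (color_graph V h c) (cycle_graph l) \<longleftrightarrow> (\<exists>f. cycle_in (color_class h c) l f)"
proof
  assume "contains_copy (color_graph V h c) (cycle_graph l)"
  then obtain f :: "nat \<Rightarrow> 'a" where f: "inj_on f {..<l}"
    and edges: "\<And>e. e \<in> {{i, Suc i mod l} |i. i < l} \<Longrightarrow> f ` e \<in> color_class h c"
    by (auto simp: contains_copy_def cycle_graph_def color_graph_def color_class_def)
  have "{f i, f (Suc i mod l)} \<in> color_class h c" if "i < l" for i
    using edges[of "{i, Suc i mod l}"] that by auto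
  with f show "\<exists>f. cycle_in (color_class h c) l f" by (auto simp: cycle_in_def)
next
  assume "\<exists>f. cycle_in (color_class h c) l f"
  then obtain f where f: "cycle_in (color_class h c) l f" ..
  then have "f i \<in> V" if "i < l" for i
    using that edges_in_color_class(1)[OF assms] unfolding cycle_in_def by blast
  with f show "contains_copy (color_graph V h c) (cycle_graph l)"
    by (auto simp: contains_copy_def cycle_graph_def color_graph_def color_class_def cycle_in_def)
qed

lemma cycle_in_length_le:
  assumes "cycle_in E l f" "finite E" "3 \<le> l"
  shows "l \<le> card E"
proof -
  have "inj_on (\<lambda>i. {f i, f (Suc i mod l)}) {..<l}"
  proof (rule inj_onI)
    fix i j assume ij: "i \<in> {..<l}" "j \<in> {..<l}" "{f i, f (Suc i mod l)} = {f j, f (Suc j mod l)}"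
    then have "i = j \<or> i = Suc j mod l \<and> Suc i mod l = j"
      using assms(1,3) by (auto simp: cycle_in_def doubleton_eq_iff inj_on_eq_iff)
    then show "i = j" using ij(1,2) assms(3) by (auto simp: mod_Suc split: if_splits)
  qed
  moreover have "(\<lambda>i. {f i, f (Suc i mod l)}) ` {..<l} \<subseteq> E"
    using assms(1) by (auto simp: cycle_in_def)
  ultimately show ?thesis using card_inj_on_le[OF _ _ assms(2)] by fastforce
qed

section \<open>Playing against a fixed Painter\<close>

inductive follows :: "'v set \<Rightarrow> ('v history \<Rightarrow> 'v set \<Rightarrow> color) \<Rightarrow> 'v history \<Rightarrow> bool"
  for V \<pi> where
  Nil: "follows V \<pi> []"
| snoc: "follows V \<pi> h \<Longrightarrow> legal_move V h e \<Longrightarrow> follows V \<pi> (h @ [(e, \<pi> h e)])"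

lemma follows_play: "builder_strategy V \<sigma> \<Longrightarrow> follows V \<pi> (play \<sigma> \<pi> k)"
  by (induction k) (auto simp: Let_def builder_strategy_def intro: follows.intros)

lemma length_play [simp]: "length (play \<sigma> \<pi> k) = k"
  by (induction k) (auto simp: Let_def)

lemma online_ramsey_ge:
  assumes "\<And>h. follows V \<pi> h \<Longrightarrow> builder_won V G1 G2 G3 h \<Longrightarrow> n \<le> length h"
  shows "enat n \<le> online_ramsey V G1 G2 G3"
  unfolding online_ramsey_def
proof (rule INF_greatest)
  fix m assume "m \<in> {n. builder_wins_within V G1 G2 G3 n}"
  then obtain \<sigma> k where "builder_strategy V \<sigma>" "k \<le> m" "builder_won V G1 G2 G3 (play \<sigma> \<pi> k)"
    unfolding builder_wins_within_def by blast
  then show "enat n \<le> enat m" using assms[OF follows_play] by fastforce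
qed

lemma follows_edges_in: "follows V \<pi> h \<Longrightarrow> edges_in V h"
  by (induction rule: follows.induct) (auto intro: edges_in_snoc)

lemma follows_length:
  assumes "follows V \<pi> h"
  shows "length h =
    card (color_class h Red) + card (color_class h Blue) + card (color_class h Green)"
  using assms
proof induction
  case (snoc h e)
  then have "e \<notin> color_class h c" for c
    by (intro edge_notin_color_class) (simp add: legal_move_def)
  with snoc.IH show ?case by (cases "\<pi> h e") (simp_all add: color_class_snoc)
qed simp

definition proper :: "('v history \<Rightarrow> 'v set \<Rightarrow> color) \<Rightarrow> bool" where
  "proper \<pi> \<longleftrightarrow> (\<forall>h e. \<pi> h e \<noteq> Green \<longrightarrow> disjnt e (touched h (\<pi> h e)))"

lemma proper_disjoint_color_class:
  assumes "proper \<pi>" "c \<noteq> Green" "follows V \<pi> h"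
  shows "disjoint (color_class h c)"
  using assms(3)
proof induction
  case (snoc h e)
  have "disjnt e (touched h c)" if "\<pi> h e = c"
    using assms(1,2) that by (auto simp: proper_def)
  with snoc.IH show ?case
    by (auto simp: color_class_snoc pairwise_insert touched_def disjnt_sym)
qed simp

lemma proper_green_copy:
  assumes "proper \<pi>" "follows V \<pi> h" "builder_won V (path_graph 3) (path_graph 3) G h"
  shows "contains_copy (color_graph V h Green) G"
  using assms contains_path3_iff[OF follows_edges_in] proper_disjoint_color_class
  unfolding builder_won_def by blast

section \<open>Two strategies of Painter\<close>

definition greedy :: "'v history \<Rightarrow> 'v set \<Rightarrow> color" where
  "greedy h e =
    (if disjnt e (touched h Red) then Red else if disjnt e (touched h Blue) then Blue else Green)"

definition red_blue_closed :: "'v history \<Rightarrow> 'v set \<Rightarrow> bool" where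
  "red_blue_closed h C \<longleftrightarrow>
    (\<forall>e \<in> color_class h Red \<union> color_class h Blue. e \<subseteq> C \<or> disjnt e C)"

definition separated :: "'v history \<Rightarrow> 'v set \<Rightarrow> bool" where
  "separated h e \<longleftrightarrow> (\<exists>C. red_blue_closed h C \<and> \<not> disjnt e C \<and> \<not> e \<subseteq> C)"

text \<open>The cautious variant never closes a red-blue cycle: the ends of \<open>e\<close> lie in different red-blue
  components iff \<open>separated h e\<close>.\<close>

definition cautious :: "'v history \<Rightarrow> 'v set \<Rightarrow> color" where
  "cautious h e = (if separated h e then greedy h e else Green)"

lemma greedy_not_Green_disjnt: "greedy h e \<noteq> Green \<Longrightarrow> disjnt e (touched h (greedy h e))"
  by (auto simp: greedy_def)

lemma greedy_eq_Green_iff: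
  "greedy h e = Green \<longleftrightarrow> \<not> disjnt e (touched h Red) \<and> \<not> disjnt e (touched h Blue)"
  by (simp add: greedy_def)

lemma proper_greedy: "proper greedy"
  by (simp add: proper_def greedy_not_Green_disjnt)

lemma proper_cautious: "proper cautious"
  by (simp add: proper_def cautious_def greedy_not_Green_disjnt)

lemma greedy_green_edge:
  assumes "follows V greedy h" "e \<in> color_class h Green"
  shows "\<not> disjnt e (touched h Red)" "\<not> disjnt e (touched h Blue)"
proof -
  from assms have "\<not> disjnt e (touched h Red) \<and> \<not> disjnt e (touched h Blue)"
  proof induction
    case (snoc h x)
    then show ?case
      using greedy_eq_Green_iff[of h x]
      by (fastforce simp: color_class_snoc touched_snoc disjnt_def split: if_splits)
  qed simp
  then show "\<not> disjnt e (touched h Red)" "\<not> disjnt e (touched h Blue)" by simp_all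
qed

definition red_blue_degree :: "'v history \<Rightarrow> 'v \<Rightarrow> nat" where
  "red_blue_degree h v = of_bool (v \<in> touched h Red) + of_bool (v \<in> touched h Blue)"

lemma red_blue_degree_append: "red_blue_degree h v \<le> red_blue_degree (h @ h') v"
  using touched_append[of h] by (auto simp: red_blue_degree_def)

lemma red_blue_closed_singleton: "red_blue_degree h v = 0 \<Longrightarrow> red_blue_closed h {v}"
  by (auto simp: red_blue_degree_def red_blue_closed_def touched_def)

lemma cautious_Green_degree:
  assumes "cautious h {u, v} = Green" "u \<noteq> v"
  shows "2 \<le> red_blue_degree h u + red_blue_degree h v"
proof (cases "separated h {u, v}")
  case True
  then have "greedy h {u, v} = Green" using assms(1) by (simp add: cautious_def)
  then show ?thesis by (auto simp: greedy_eq_Green_iff red_blue_degree_def)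
next
  case False
  then have "red_blue_degree h u \<noteq> 0" "red_blue_degree h v \<noteq> 0"
    using assms(2) red_blue_closed_singleton[of h] by (fastforce simp: separated_def)+
  then show ?thesis by simp
qed

lemma cautious_green_edge_degree:
  assumes "follows V cautious h" "{u, v} \<in> color_class h Green"
  shows "2 \<le> red_blue_degree h u + red_blue_degree h v"
  using assms
proof induction
  case (snoc h e)
  let ?h' = "h @ [(e, cautious h e)]"
  have "2 \<le> red_blue_degree h u + red_blue_degree h v"
  proof (cases "{u, v} \<in> color_class h Green")
    case True
    then show ?thesis by (rule snoc.IH)
  next
    case False
    with snoc.prems have e: "e = {u, v}" "cautious h e = Green"
      by (auto simp: color_class_snoc split: if_splits)
    moreover from e(1) snoc.hyps(2) have "u \<noteq> v" by (auto simp: legal_move_def)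
    ultimately show ?thesis using cautious_Green_degree[of h u v] by simp
  qed
  then show ?case
    using red_blue_degree_append[of h u] red_blue_degree_append[of h v]
    by (meson add_mono order_trans)
qed simp

lemma cautious_blue_edge:
  assumes "follows V cautious h" "e \<in> color_class h Blue"
  shows "\<not> disjnt e (touched h Red)"
  using assms
proof induction
  case (snoc h x)
  then show ?case
    by (auto simp: color_class_snoc touched_snoc cautious_def greedy_def disjnt_def
        split: if_splits)
qed simp

lemma separated_if_no_blue:
  assumes "color_class h Blue = {}" "disjoint (color_class h Red)" "edges_in V h" "legal_move V h e"
  shows "separated h e"
proof -
  obtain u v where e: "e = {u, v}" "u \<noteq> v"
    using assms(4) by (auto simp: legal_move_def card_2_iff)
  have "\<exists>C. red_blue_closed h C \<and> u \<in> C \<and> v \<notin> C"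
  proof (cases "\<exists>e' \<in> color_class h Red. u \<in> e'")
    case True
    then obtain e' where e': "e' \<in> color_class h Red" "u \<in> e'" by blast
    have "red_blue_closed h e'"
      using assms(1,2) e'(1) by (auto simp: red_blue_closed_def pairwise_def)
    moreover have "v \<notin> e'"
    proof
      assume "v \<in> e'"
      with e e'(2) edges_in_color_class[OF assms(3) e'(1)] have "e = e'" by (auto simp: card_2_iff)
      with e'(1) assms(4) show False by (auto simp: legal_move_def edge_notin_color_class)
    qed
    ultimately show ?thesis using e'(2) by blast
  next
    case False
    then have "red_blue_closed h {u}" using assms(1) by (auto simp: red_blue_closed_def)
    then show ?thesis using e(2) by blast
  qed
  then show ?thesis using e(1) by (auto simp: separated_def)
qed

lemma cautious_touched_meet:
  assumes "follows V cautious h" "color_class h Green \<noteq> {}"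
  shows "touched h Red \<inter> touched h Blue \<noteq> {}"
  using assms
proof induction
  case (snoc h e)
  have "touched h Red \<inter> touched h Blue \<noteq> {}"
  proof (cases "color_class h Green = {}")
    case False
    then show ?thesis by (rule snoc.IH)
  next
    case True
    then have green: "cautious h e = Green"
      using snoc.prems by (auto simp: color_class_snoc split: if_splits)
    have "color_class h Blue \<noteq> {}"
    proof
      assume noblue: "color_class h Blue = {}"
      have "disjoint (color_class h Red)"
        using proper_disjoint_color_class[OF proper_cautious _ snoc.hyps(1)] by simp
      then have "separated h e"
        using separated_if_no_blue[OF noblue] follows_edges_in snoc.hyps by blast
      with green noblue show False by (simp add: cautious_def greedy_eq_Green_iff touched_def)
    qed
    then show ?thesis
      using cautious_blue_edge[OF snoc.hyps(1)] by (fastforce simp: touched_def disjnt_def)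
  qed
  then show ?case using touched_append[of h] by blast
qed simp

lemma even_card_closed_touched:
  assumes "edges_in V h" "disjoint (color_class h c)" "red_blue_closed h C" "c \<noteq> Green"
  shows "even (card (C \<inter> touched h c))"
proof -
  have "C \<inter> touched h c = \<Union> {e \<in> color_class h c. e \<subseteq> C}"
    using assms(3,4) unfolding red_blue_closed_def touched_def disjnt_def by (cases c) blast+
  moreover have "even (card (\<Union> {e \<in> color_class h c. e \<subseteq> C}))"
  proof (rule dvd_partition)
    show "finite (\<Union> {e \<in> color_class h c. e \<subseteq> C})"
      by (rule finite_subset[OF _ finite_touched[OF assms(1), of c]]) (auto simp: touched_def)
  qed (use assms(2) edges_in_color_class(2)[OF assms(1)] in \<open>auto simp: disjoint_def\<close>)
  ultimately show ?thesis by simp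
qed

text \<open>The side of the cut that admitted the last red or blue edge contains one end of it, hence an
  odd number of vertices touched by its color and an even number touched by the other one.\<close>

lemma cautious_touched_neq:
  assumes "follows V cautious h" "color_class h Red \<union> color_class h Blue \<noteq> {}"
  shows "touched h Red \<noteq> touched h Blue"
  using assms
proof induction
  case (snoc h e)
  let ?h' = "h @ [(e, cautious h e)]"
  show ?case
  proof (cases "cautious h e = Green")
    case True
    with snoc show ?thesis by (simp add: color_class_snoc touched_snoc)
  next
    case False
    define c where "c = cautious h e"
    obtain d where d: "d \<noteq> c" "d \<noteq> Green" "{c, d} = {Red, Blue}"
      using False c_def by (cases c) auto
    obtain C where C: "red_blue_closed h C" "\<not> disjnt e C" "\<not> e \<subseteq> C"
      using False by (auto simp: cautious_def separated_def split: if_splits)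
    have new: "disjnt e (touched h c)"
      using proper_cautious False unfolding proper_def c_def by blast
    have even: "even (card (C \<inter> touched h x))" if "x \<noteq> Green" for x
      using even_card_closed_touched[OF follows_edges_in proper_disjoint_color_class C(1) that]
        proper_cautious snoc.hyps(1) that by blast
    have "card (C \<inter> e) = 1"
    proof -
      have "card e = 2" using snoc.hyps(2) by (simp add: legal_move_def)
      then show ?thesis using C(2,3) by (auto simp: card_2_iff disjnt_def Int_insert_right)
    qed
    then have "odd (card (C \<inter> e \<union> C \<inter> touched h c))"
      using new even[of c] False c_def finite_touched[OF follows_edges_in[OF snoc.hyps(1)], of c]
      by (subst card_Un_disjoint) (auto simp: disjnt_def intro: card_ge_0_finite)
    then have "C \<inter> touched ?h' c \<noteq> C \<inter> touched ?h' d"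
      using even[OF d(2)] d(1) by (auto simp: touched_snoc c_def Int_Un_distrib)
    then show ?thesis using d(3) by (auto simp: doubleton_eq_iff)
  qed
qed simp

section \<open>The lower bound\<close>

lemma bij_betw_Suc_mod: "bij_betw (\<lambda>i. Suc i mod l) {..<l} {..<l}"
proof (cases "l = 0")
  case False
  have "inj_on (\<lambda>i. Suc i mod l) {..<l}" by (auto simp: inj_on_def mod_Suc split: if_splits)
  moreover have "(\<lambda>i. Suc i mod l) ` {..<l} \<subseteq> {..<l}" using False by auto
  ultimately show ?thesis by (simp add: bij_betw_def endo_inj_surj)
qed (simp add: bij_betw_def)

lemma sum_cyclic_pairs: "(\<Sum>i<l. g i + g (Suc i mod l)) = 2 * (\<Sum>i<l. g i :: nat)"
  using sum.reindex_bij_betw[OF bij_betw_Suc_mod, of g l] by (simp add: sum.distrib)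

lemma sum_ge_if_cyclic_pairs_ge:
  fixes g :: "nat \<Rightarrow> nat"
  assumes "\<And>i. i < l \<Longrightarrow> a \<le> g i + g (Suc i mod l)"
  shows "a * l \<le> 2 * (\<Sum>i<l. g i)"
proof -
  have "(\<Sum>i<l. a) \<le> (\<Sum>i<l. g i + g (Suc i mod l))" using assms by (intro sum_mono) auto
  then show ?thesis by (simp add: sum_cyclic_pairs mult.commute)
qed

lemma cyclic_pairs_eq_if_sum_eq:
  fixes g :: "nat \<Rightarrow> nat"
  assumes "\<And>i. i < l \<Longrightarrow> a \<le> g i + g (Suc i mod l)" "2 * (\<Sum>i<l. g i) = a * l" "i < l"
  shows "g i + g (Suc i mod l) = a"
proof (rule ccontr)
  assume "g i + g (Suc i mod l) \<noteq> a"
  then have "\<exists>i \<in> {..<l}. a < g i + g (Suc i mod l)" using assms(1,3) by (force simp: less_le)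
  then have "(\<Sum>i<l. a) < (\<Sum>i<l. g i + g (Suc i mod l))"
    using assms(1) by (intro sum_strict_mono_ex1) auto
  then show False using assms(2) by (simp add: sum_cyclic_pairs)
qed

lemma all_one_or_none_one_if_cyclic_pairs_eq_2:
  fixes g :: "nat \<Rightarrow> nat"
  assumes "\<And>i. i < l \<Longrightarrow> g i + g (Suc i mod l) = 2"
  shows "(\<forall>i<l. g i = 1) \<or> (\<forall>i<l. g i \<noteq> 1)"
proof -
  have "g i = 1 \<longleftrightarrow> g 0 = 1" if "i < l" for i
    using that
  proof (induction i)
    case (Suc i)
    then show ?case using assms[of i] by auto
  qed simp
  then show ?thesis by blast
qed

lemma card_image_Int:
  assumes "inj_on f A"
  shows "card (f ` A \<inter> X) = card (A \<inter> {x. f x \<in> X})"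
proof -
  have "f ` A \<inter> X = f ` (A \<inter> {x. f x \<in> X})" by blast
  moreover have "inj_on f (A \<inter> {x. f x \<in> X})" using assms by (rule inj_on_subset) blast
  ultimately show ?thesis by (simp add: card_image)
qed

lemma greedy_cycle_length:
  assumes "follows V greedy h" "cycle_in (color_class h Green) l f" "3 \<le> l"
  shows "l + 2 * ((l + 3) div 4) \<le> length h"
proof -
  note edges_in = follows_edges_in[OF assms(1)]
  have "(l + 3) div 4 \<le> card (color_class h c)" if c: "c \<in> {Red, Blue}" for c
  proof -
    have "1 * l \<le> 2 * (\<Sum>i<l. of_bool (f i \<in> touched h c))"
    proof (rule sum_ge_if_cyclic_pairs_ge)
      fix i assume "i < l"
      then have "{f i, f (Suc i mod l)} \<in> color_class h Green"
        using assms(2) by (simp add: cycle_in_def)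
      then show "1 \<le> of_bool (f i \<in> touched h c) + (of_bool (f (Suc i mod l) \<in> touched h c) :: nat)"
        using greedy_green_edge[OF assms(1)] c by (auto simp: disjnt_def)
    qed
    also have "(\<Sum>i<l. of_bool (f i \<in> touched h c)) = card (f ` {..<l} \<inter> touched h c)"
      using assms(2) by (simp add: cycle_in_def card_image_Int)
    also have "\<dots> \<le> card (touched h c)" using edges_in by (intro card_mono finite_touched) auto
    also have "\<dots> = 2 * card (color_class h c)"
      using card_touched[OF edges_in] proper_disjoint_color_class[OF proper_greedy _ assms(1)] c
      by blast
    finally show ?thesis by simp
  qed
  from this[of Red] this[of Blue] show ?thesis
    using cycle_in_length_le[OF assms(2) _ assms(3)] follows_length[OF assms(1)] by simp
qed

text \<open>In the case of equality no red or blue edge leaves the green cycle, and the degrees of any two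
  consecutive vertices add up to 2. Hence they are all 1, or all 0 or 2.\<close>

lemma cautious_tight_cycle:
  assumes "follows V cautious h" "cycle_in (color_class h Green) l f" "3 \<le> l"
    and "2 * length h \<le> 3 * l"
  shows "touched h Red \<subseteq> f ` {..<l}" "touched h Blue \<subseteq> f ` {..<l}"
    and "\<And>i. i < l \<Longrightarrow> red_blue_degree h (f i) + red_blue_degree h (f (Suc i mod l)) = 2"
proof -
  let ?C = "f ` {..<l}" and ?deg = "\<lambda>i. red_blue_degree h (f i)"
  have "l \<le> card (color_class h Green)" using cycle_in_length_le[OF assms(2) _ assms(3)] by simp
  then have few: "2 * card (color_class h Red) + 2 * card (color_class h Blue) \<le> l"
    using follows_length[OF assms(1)] assms(4) by simp
  note finite_touched = finite_touched[OF follows_edges_in[OF assms(1)]]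
  have card: "card (touched h c) = 2 * card (color_class h c)" if "c \<noteq> Green" for c
    using card_touched[OF follows_edges_in proper_disjoint_color_class[OF proper_cautious that]]
      assms(1) by blast
  have le: "card (?C \<inter> touched h c) \<le> card (touched h c)" for c
    using finite_touched by (intro card_mono) auto
  have deg: "2 \<le> ?deg i + ?deg (Suc i mod l)" if "i < l" for i
    using assms(2) that by (intro cautious_green_edge_degree[OF assms(1)]) (simp add: cycle_in_def)
  have sum: "(\<Sum>i<l. ?deg i) = card (?C \<inter> touched h Red) + card (?C \<inter> touched h Blue)"
    using assms(2) by (simp add: red_blue_degree_def cycle_in_def sum.distrib card_image_Int)
  have "2 * l \<le> 2 * (\<Sum>i<l. ?deg i)" using deg by (rule sum_ge_if_cyclic_pairs_ge)
  then have tight: "(\<Sum>i<l. ?deg i) = l"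
    and "card (?C \<inter> touched h Red) = card (touched h Red)"
    and "card (?C \<inter> touched h Blue) = card (touched h Blue)"
    using few le[of Red] le[of Blue] card[of Red] card[of Blue] unfolding sum by auto
  then show "touched h Red \<subseteq> ?C" "touched h Blue \<subseteq> ?C"
    using card_subset_eq[OF finite_touched, of "?C \<inter> _"] by blast+
  show "?deg i + ?deg (Suc i mod l) = 2" if "i < l" for i
    using deg _ that by (rule cyclic_pairs_eq_if_sum_eq) (simp_all add: tight)
qed

lemma cautious_cycle_length:
  assumes "follows V cautious h" "cycle_in (color_class h Green) l f" "3 \<le> l"
  shows "3 * l < 2 * length h"
proof (rule ccontr)
  let ?deg = "\<lambda>i. red_blue_degree h (f i)"
  assume "\<not> 3 * l < 2 * length h"
  then have "2 * length h \<le> 3 * l" by simp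
  note on_cycle = cautious_tight_cycle(1,2)[OF assms this]
    and pairs = cautious_tight_cycle(3)[OF assms this]
  consider "\<forall>i<l. ?deg i = 1" | "\<forall>i<l. ?deg i \<noteq> 1"
    using all_one_or_none_one_if_cyclic_pairs_eq_2[of l ?deg] pairs by blast
  then show False
  proof cases
    case 1
    then have "touched h Red \<inter> touched h Blue = {}"
      using on_cycle(1) by (fastforce simp: red_blue_degree_def)
    moreover have "color_class h Green \<noteq> {}"
      using assms(2,3) unfolding cycle_in_def by (metis empty_iff less_le_trans zero_less_numeral)
    ultimately show False using cautious_touched_meet[OF assms(1)] by blast
  next
    case 2
    then have "f i \<in> touched h Red \<longleftrightarrow> f i \<in> touched h Blue" if "i < l" for i
      using that by (auto simp: red_blue_degree_def of_bool_def split: if_splits)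
    then have "touched h Red = touched h Blue" using on_cycle by blast
    moreover have "color_class h Red \<union> color_class h Blue \<noteq> {}"
      using pairs[of 0] assms(3) by (auto simp: red_blue_degree_def touched_def)
    ultimately show False using cautious_touched_neq[OF assms(1)] by blast
  qed
qed

definition optimal_rounds :: "nat \<Rightarrow> nat" where
  "optimal_rounds l = (if l mod 4 = 3 then (3 * l + 1) div 2 else (3 * (l + 1)) div 2)"

lemma optimal_rounds_le_greedy:
  assumes "\<not> 4 dvd l"
  shows "optimal_rounds l \<le> l + 2 * ((l + 3) div 4)"
proof -
  have "\<exists>q. l = 4 * q + 1 \<or> l = 4 * q + 2 \<or> l = 4 * q + 3" using assms by presburger
  then consider q where "l = 4 * q + 1" | q where "l = 4 * q + 2" | q where "l = 4 * q + 3" by blast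
  then show ?thesis unfolding optimal_rounds_def by cases (simp_all, linarith)
qed

lemma online_ramsey_lower_bound:
  assumes "3 \<le> l"
  shows "enat (optimal_rounds l) \<le> online_ramsey V (path_graph 3) (path_graph 3) (cycle_graph l)"
proof (cases "4 dvd l")
  case True
  show ?thesis
  proof (rule online_ramsey_ge)
    fix h assume h: "follows V cautious h"
      and "builder_won V (path_graph 3) (path_graph 3) (cycle_graph l) h"
    then obtain f where "cycle_in (color_class h Green) l f"
      using proper_green_copy[OF proper_cautious] contains_cycle_iff[OF follows_edges_in] by blast
    from cautious_cycle_length[OF h this assms] show "optimal_rounds l \<le> length h"
      using True unfolding optimal_rounds_def by (elim dvdE) simp
  qed
next
  case False
  show ?thesis
  proof (rule online_ramsey_ge)
    fix h assume h: "follows V greedy h"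
      and "builder_won V (path_graph 3) (path_graph 3) (cycle_graph l) h"
    then obtain f where "cycle_in (color_class h Green) l f"
      using proper_green_copy[OF proper_greedy] contains_cycle_iff[OF follows_edges_in] by blast
    from greedy_cycle_length[OF h this assms] show "optimal_rounds l \<le> length h"
      using optimal_rounds_le_greedy[OF False] by simp
  qed
qed

section \<open>Forcing a win within a given number of rounds\<close>

primrec forces :: "'v set \<Rightarrow> ('v history \<Rightarrow> bool) \<Rightarrow> nat \<Rightarrow> 'v history \<Rightarrow> bool" where
  "forces V W 0 h \<longleftrightarrow> W h"
| "forces V W (Suc n) h \<longleftrightarrow>
    W h \<or> (\<exists>e. legal_move V h e \<and> (\<forall>c. forces V W n (h @ [(e, c)])))"

lemma forces_if_won: "W h \<Longrightarrow> forces V W n h"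
  by (cases n) auto

lemma forces_mono:
  assumes "forces V W n h" "n \<le> m"
  shows "forces V W m h"
  using assms
proof (induction n arbitrary: h m)
  case 0
  then show ?case by (simp add: forces_if_won)
next
  case (Suc n)
  then obtain m' where m': "m = Suc m'" "n \<le> m'" by (metis Suc_le_D Suc_le_mono)
  then show ?case using Suc.prems(1) Suc.IH[OF _ m'(2)] by auto
qed

lemma legal_move_exists:
  assumes "infinite V"
  shows "\<exists>e. legal_move V h e"
proof -
  obtain x where x: "x \<in> V" using assms infinite_imp_nonempty by blast
  have "infinite ((\<lambda>y. {x, y}) ` (V - {x}))"
    using assms by (subst finite_image_iff) (auto simp: inj_on_def doubleton_eq_iff)
  then obtain e where "e \<in> (\<lambda>y. {x, y}) ` (V - {x})" "e \<notin> fst ` set h"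
    by (metis List.finite_set finite_imageI finite_subset subsetI)
  with x show ?thesis by (auto simp: legal_move_def intro!: exI[of _ e])
qed

lemma forces_imp_builder_wins_within:
  assumes "infinite V" "forces V (builder_won V G1 G2 G3) n []"
  shows "builder_wins_within V G1 G2 G3 n"
proof -
  let ?W = "builder_won V G1 G2 G3"
  define good where
    "good h e \<longleftrightarrow> (\<forall>c. forces V ?W (n - Suc (length h)) (h @ [(e, c)]))" for h e
  have "\<exists>e. legal_move V h e \<and> ((\<exists>e. legal_move V h e \<and> good h e) \<longrightarrow> good h e)" for h
    using legal_move_exists[OF assms(1)] by blast
  then obtain \<sigma> where legal: "legal_move V h (\<sigma> h)"
    and good: "(\<exists>e. legal_move V h e \<and> good h e) \<longrightarrow> good h (\<sigma> h)" for h
    by metis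
  have "\<exists>k\<le>n. ?W (play \<sigma> \<pi> k)" for \<pi>
  proof (rule ccontr)
    assume not_won: "\<not> (\<exists>k\<le>n. ?W (play \<sigma> \<pi> k))"
    have "k \<le> n \<Longrightarrow> forces V ?W (n - k) (play \<sigma> \<pi> k)" for k
    proof (induction k)
      case 0
      then show ?case using assms(2) by simp
    next
      case (Suc k)
      then have "forces V ?W (Suc (n - Suc k)) (play \<sigma> \<pi> k)" by (simp add: Suc_diff_Suc)
      moreover have "\<not> ?W (play \<sigma> \<pi> k)" using not_won Suc.prems by simp
      ultimately have "\<exists>e. legal_move V (play \<sigma> \<pi> k) e \<and> good (play \<sigma> \<pi> k) e"
        by (simp add: good_def)
      then have "good (play \<sigma> \<pi> k) (\<sigma> (play \<sigma> \<pi> k))" using good by blast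
      then show ?case by (simp add: good_def Let_def)
    qed
    from this[of n] not_won show False by auto
  qed
  with legal show ?thesis by (auto simp: builder_wins_within_def builder_strategy_def)
qed

lemma online_ramsey_le:
  assumes "infinite V" "forces V (builder_won V G1 G2 G3) n []"
  shows "online_ramsey V G1 G2 G3 \<le> enat n"
  unfolding online_ramsey_def
  using forces_imp_builder_wins_within[OF assms] by (intro INF_lower) simp

abbreviation won :: "'v set \<Rightarrow> nat \<Rightarrow> 'v history \<Rightarrow> bool" where
  "won V l \<equiv> builder_won V (path_graph 3) (path_graph 3) (cycle_graph l)"

lemma won_if_touched:
  assumes "edges_in V h" "legal_move V h e" "c \<noteq> Green" "\<not> disjnt e (touched h c)"
  shows "won V l (h @ [(e, c)])"
proof -
  obtain e' where e': "e' \<in> color_class h c" "\<not> disjnt e e'"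
    using assms(4) by (auto simp: touched_def disjnt_def)
  moreover have "e \<noteq> e'" using assms(2) e'(1) edge_notin_color_class by (auto simp: legal_move_def)
  ultimately have "\<not> disjoint (color_class (h @ [(e, c)]) c)"
    by (auto simp: color_class_snoc pairwise_insert)
  then have "contains_copy (color_graph V (h @ [(e, c)]) c) (path_graph 3)"
    using contains_path3_iff edges_in_snoc[OF assms(1,2)] by blast
  with assms(3) show ?thesis by (cases c) (auto simp: builder_won_def)
qed

section \<open>Green paths\<close>

definition green_path :: "'v history \<Rightarrow> 'v list \<Rightarrow> bool" where
  "green_path h Q \<longleftrightarrow> distinct Q \<and> successively (\<lambda>x y. {x, y} \<in> color_class h Green) Q"

lemma green_path_mono: "green_path h Q \<Longrightarrow> set h \<subseteq> set h' \<Longrightarrow> green_path h' Q"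
  unfolding green_path_def color_class_def by (auto elim: successively_mono)

lemma green_path_rev [simp]: "green_path h (rev Q) \<longleftrightarrow> green_path h Q"
  by (simp add: green_path_def insert_commute)

lemma won_if_green_cycle:
  assumes "edges_in V h" "green_path h Q" "Q \<noteq> []" "{last Q, hd Q} \<in> color_class h Green"
  shows "won V (length Q) h"
proof -
  have "{Q ! i, Q ! (Suc i mod length Q)} \<in> color_class h Green" if "i < length Q" for i
  proof (cases "Suc i < length Q")
    case True
    then show ?thesis using assms(2) by (simp add: green_path_def successively_conv_nth)
  next
    case False
    then have "i = length Q - 1" using that by simp
    then show ?thesis using assms(3,4) by (simp add: last_conv_nth hd_conv_nth)
  qed
  then have "cycle_in (color_class h Green) (length Q) ((!) Q)"
    using assms(2) by (auto simp: cycle_in_def green_path_def intro: inj_on_nth)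
  then show ?thesis using contains_cycle_iff[OF assms(1)] unfolding builder_won_def by blast
qed

definition steps :: "'a list \<Rightarrow> ('a \<times> 'a) list" where
  "steps xs = zip xs (tl xs)"

lemma steps_snoc: "xs \<noteq> [] \<Longrightarrow> steps (xs @ [x]) = steps xs @ [(last xs, x)]"
  by (induction xs rule: induct_list012) (auto simp: steps_def)

lemma successively_iff_steps: "successively P xs \<longleftrightarrow> (\<forall>(x, y) \<in> set (steps xs). P x y)"
  by (induction xs rule: induct_list012) (auto simp: steps_def)

section \<open>Boards\<close>

text \<open>A board describes a history up to exchanging red and blue, its vertices being named by natural
  numbers. It records vertices known to be touched by red and by blue, some green edges, and pairs
  that may have been drawn already. All other pairs have not been drawn, so names that occur nowhere
  denote fresh vertices.\<close>

datatype board = Board (reds: "nat list") (blues: "nat list")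
  (greens: "(nat \<times> nat) list") (others: "(nat \<times> nat) list")

definition hits :: "nat \<times> nat \<Rightarrow> nat list \<Rightarrow> bool" where
  "hits e xs \<longleftrightarrow> fst e \<in> set xs \<or> snd e \<in> set xs"

definition joined :: "(nat \<times> nat) list \<Rightarrow> nat \<times> nat \<Rightarrow> bool" where
  "joined es e \<longleftrightarrow> e \<in> set es \<or> prod.swap e \<in> set es"

definition undrawn :: "board \<Rightarrow> nat \<times> nat \<Rightarrow> bool" where
  "undrawn b e \<longleftrightarrow> fst e \<noteq> snd e \<and> \<not> joined (greens b) e \<and> \<not> joined (others b) e"

definition swap_colors :: "board \<Rightarrow> board" where
  [simp]: "swap_colors b = Board (blues b) (reds b) (greens b) (others b)"

definition add_red :: "nat \<times> nat \<Rightarrow> board \<Rightarrow> board" where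
  [simp]: "add_red e b = Board (fst e # snd e # reds b) (blues b) (greens b) (e # others b)"

definition add_blue :: "nat \<times> nat \<Rightarrow> board \<Rightarrow> board" where
  [simp]: "add_blue e b = Board (reds b) (fst e # snd e # blues b) (greens b) (e # others b)"

definition add_green :: "nat \<times> nat \<Rightarrow> board \<Rightarrow> board" where
  [simp]: "add_green e b = Board (reds b) (blues b) (e # greens b) (others b)"

definition image_edge :: "(nat \<Rightarrow> 'v) \<Rightarrow> nat \<times> nat \<Rightarrow> 'v set" where
  "image_edge f e = {f (fst e), f (snd e)}"

definition realizes ::
    "'v set \<Rightarrow> 'v history \<Rightarrow> (nat \<Rightarrow> 'v) \<Rightarrow> color \<Rightarrow> color \<Rightarrow> board \<Rightarrow> bool" where
  "realizes V h f c d b \<longleftrightarrow> edges_in V h \<and> inj f \<and> range f \<subseteq> V \<and> {c, d} = {Red, Blue} \<and>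
    f ` set (reds b) \<subseteq> touched h c \<and> f ` set (blues b) \<subseteq> touched h d \<and>
    image_edge f ` set (greens b) \<subseteq> color_class h Green \<and>
    (\<forall>e. undrawn b e \<longrightarrow> image_edge f e \<notin> fst ` set h)"

lemma image_edge_eq_iff:
  "inj f \<Longrightarrow> image_edge f e = image_edge f e' \<longleftrightarrow> e = e' \<or> e = prod.swap e'"
  by (cases e; cases e') (auto simp: image_edge_def doubleton_eq_iff inj_eq)

lemma image_edge_swap [simp]: "image_edge f (prod.swap e) = image_edge f e"
  by (auto simp: image_edge_def)

lemma mem_image_edge [simp]: "f (fst e) \<in> image_edge f e" "f (snd e) \<in> image_edge f e"
  by (simp_all add: image_edge_def)

lemma joined_Cons: "joined (e' # es) e \<longleftrightarrow> e = e' \<or> e = prod.swap e' \<or> joined es e"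
  by (auto simp: joined_def)

lemma realizes_legal_move:
  assumes "realizes V h f c d b" "undrawn b e"
  shows "legal_move V h (image_edge f e)"
  using assms by (auto simp: realizes_def legal_move_def undrawn_def image_edge_def inj_eq)

lemma realizes_swap_colors: "realizes V h f c d b \<Longrightarrow> realizes V h f d c (swap_colors b)"
  by (auto simp: realizes_def undrawn_def insert_commute)

lemma realizes_add_green:
  assumes "realizes V h f c d b" "undrawn b e"
  shows "realizes V (h @ [(image_edge f e, Green)]) f c d (add_green e b)"
  using assms realizes_legal_move[OF assms]
  by (auto simp: realizes_def undrawn_def joined_Cons image_edge_eq_iff edges_in_snoc touched_snoc
      color_class_snoc)

lemma realizes_add_green_if_joined:
  assumes "realizes V h f c d b" "joined (greens b) e"
  shows "realizes V h f c d (add_green e b)"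
proof -
  have "image_edge f e \<in> color_class h Green"
    using assms unfolding realizes_def joined_def by (metis image_edge_swap imageI subsetD)
  with assms show ?thesis by (auto simp: realizes_def undrawn_def joined_Cons)
qed

lemma realizes_add_red:
  assumes "realizes V h f c d b" "undrawn b e"
  shows "realizes V (h @ [(image_edge f e, c)]) f c d (add_red e b)"
proof -
  have "c \<noteq> Green" "c \<noteq> d" using assms(1) by (auto simp: realizes_def doubleton_eq_iff)
  then show ?thesis using assms realizes_legal_move[OF assms]
    by (auto simp: realizes_def undrawn_def joined_Cons image_edge_eq_iff edges_in_snoc touched_snoc
        color_class_snoc)
qed

lemma realizes_add_blue:
  assumes "realizes V h f c d b" "undrawn b e"
  shows "realizes V (h @ [(image_edge f e, d)]) f c d (add_blue e b)"
proof -
  have "undrawn (swap_colors b) e" using assms(2) by (simp add: undrawn_def)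
  from realizes_swap_colors[OF realizes_add_red[OF realizes_swap_colors[OF assms(1)] this]]
  show ?thesis by simp
qed

lemma won_if_hits_reds:
  assumes "realizes V h f c d b" "undrawn b e" "hits e (reds b)"
  shows "won V l (h @ [(image_edge f e, c)])"
proof (rule won_if_touched)
  show "\<not> disjnt (image_edge f e) (touched h c)"
    using assms(1,3) by (auto simp: realizes_def hits_def image_edge_def disjnt_def)
qed (use assms realizes_legal_move[OF assms(1,2)] in \<open>auto simp: realizes_def doubleton_eq_iff\<close>)

lemma won_if_hits_blues:
  assumes "realizes V h f c d b" "undrawn b e" "hits e (blues b)"
  shows "won V l (h @ [(image_edge f e, d)])"
proof (rule won_if_hits_reds)
  show "realizes V h f d c (swap_colors b)" using assms(1) by (rule realizes_swap_colors)
qed (use assms in \<open>simp_all add: undrawn_def\<close>)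

lemma forces_Suc_if_undrawn:
  assumes real: "realizes V h f c d b" and undrawn: "undrawn b e"
    and red: "\<And>h' c d. \<not> hits e (reds b) \<Longrightarrow> set h \<subseteq> set h' \<Longrightarrow> realizes V h' f c d (add_red e b) \<Longrightarrow>
      forces V (won V l) n h'"
    and blue: "\<And>h'. \<not> hits e (blues b) \<Longrightarrow> set (reds b) \<noteq> set (blues b) \<Longrightarrow> set h \<subseteq> set h' \<Longrightarrow>
      realizes V h' f c d (add_blue e b) \<Longrightarrow> forces V (won V l) n h'"
    and green: "\<And>h'. set h \<subseteq> set h' \<Longrightarrow> realizes V h' f c d (add_green e b) \<Longrightarrow>
      forces V (won V l) n h'"
  shows "forces V (won V l) (Suc n) h"
proof -
  have "forces V (won V l) n (h @ [(image_edge f e, x)])" (is "forces _ _ _ ?h'") for x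
  proof -
    have "set h \<subseteq> set ?h'" by auto
    have "{c, d} = {Red, Blue}" using real by (simp add: realizes_def)
    then consider "x = Green" | "x = c" | "x = d" by (cases x) (auto simp: doubleton_eq_iff)
    then show ?thesis
    proof cases
      case 1
      then show ?thesis using green[OF _ realizes_add_green[OF real undrawn]] by auto
    next
      case 2
      then show ?thesis
        using red[OF _ _ realizes_add_red[OF real undrawn]] won_if_hits_reds[OF real undrawn]
        by (cases "hits e (reds b)") (auto intro: forces_if_won)
    next
      case 3
      have swapped: "realizes V h f d c b" if "set (reds b) = set (blues b)"
        using real that by (auto simp: realizes_def)
      consider "hits e (blues b)" | "\<not> hits e (blues b)" "set (reds b) = set (blues b)"
        | "\<not> hits e (blues b)" "set (reds b) \<noteq> set (blues b)" by blast
      then show ?thesis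
      proof cases
        case 2
        then show ?thesis
          using red[OF _ _ realizes_add_red[OF swapped undrawn]] 3 by (auto simp: hits_def)
      qed (use 3 blue[OF _ _ _ realizes_add_blue[OF real undrawn]]
          won_if_hits_blues[OF real undrawn] in \<open>auto intro: forces_if_won\<close>)
    qed
  qed
  then show ?thesis using realizes_legal_move[OF real undrawn] by auto
qed

definition forced_green :: "board \<Rightarrow> (nat \<times> nat) list \<Rightarrow> bool" where
  "forced_green b es \<longleftrightarrow>
    (\<forall>e \<in> set es. joined (greens b) e \<or> undrawn b e \<and> hits e (reds b) \<and> hits e (blues b))"

abbreviation draw :: "(nat \<times> nat) list \<Rightarrow> board \<Rightarrow> board" where
  "draw \<equiv> fold add_green"

primrec missing :: "board \<Rightarrow> (nat \<times> nat) list \<Rightarrow> nat" where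
  "missing b [] = 0"
| "missing b (e # es) = (if joined (greens b) e then 0 else 1) + missing (add_green e b) es"

lemma greens_draw: "set (greens (draw es b)) = set es \<union> set (greens b)"
proof (induction es arbitrary: b)
  case (Cons e es)
  then show ?case by auto
qed simp

lemma forces_if_forces_draw:
  assumes "realizes V h f c d b" "forced_green b es"
    and "\<And>h'. set h \<subseteq> set h' \<Longrightarrow> realizes V h' f c d (draw es b) \<Longrightarrow> forces V (won V l) n h'"
  shows "forces V (won V l) (missing b es + n) h"
  using assms
proof (induction es arbitrary: b h)
  case (Cons e es)
  let ?m = "missing (add_green e b) es + n"
  have "forced_green (add_green e b) es"
    using Cons.prems(2) by (auto simp: forced_green_def joined_Cons undrawn_def)
  then have forces: "forces V (won V l) ?m h'"
    if "set h \<subseteq> set h'" "realizes V h' f c d (add_green e b)" for h'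
    using that Cons.prems(3) by (intro Cons.IH) auto
  show ?case
  proof (cases "joined (greens b) e")
    case True
    then show ?thesis
      using forces[OF order_refl realizes_add_green_if_joined[OF Cons.prems(1)]] by simp
  next
    case False
    then have "undrawn b e" "hits e (reds b)" "hits e (blues b)"
      using Cons.prems(2) by (auto simp: forced_green_def)
    then have "forces V (won V l) (Suc ?m) h"
      using forces by (intro forces_Suc_if_undrawn[OF Cons.prems(1)]) auto
    then show ?thesis using False by simp
  qed
qed simp

section \<open>Prolonging the green path\<close>

text \<open>Without a \<open>link\<close> Builder has no green path yet.\<close>

definition attached :: "(nat \<Rightarrow> 'v) \<Rightarrow> bool \<Rightarrow> 'v list \<Rightarrow> bool" where
  "attached f link Q \<longleftrightarrow>
    (if link then Q \<noteq> [] \<and> hd Q = f 0 \<and> last Q = f 1 \<and> set Q \<inter> range f = {f 0, f 1} else Q = [])"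

definition walk :: "bool \<Rightarrow> nat list \<Rightarrow> nat list \<Rightarrow> nat list" where
  "walk link p q = p @ (if link then [0, 1] else []) @ q"

definition walk_edges :: "bool \<Rightarrow> nat list \<Rightarrow> nat list \<Rightarrow> (nat \<times> nat) list" where
  "walk_edges link p q = (if link then steps (p @ [0]) @ steps (1 # q) else steps (p @ q))"

definition prolong :: "(nat \<Rightarrow> 'v) \<Rightarrow> nat list \<Rightarrow> 'v list \<Rightarrow> nat list \<Rightarrow> 'v list" where
  "prolong f p Q q = map f p @ Q @ map f q"

lemma mem_attached:
  assumes "inj f" "attached f link Q"
  shows "f x \<in> set Q \<longleftrightarrow> link \<and> x \<in> {0, 1}"
proof (cases link)
  case True
  then have "set Q \<inter> range f = {f 0, f 1}" using assms(2) by (simp add: attached_def)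
  then have "f x \<in> set Q \<longleftrightarrow> f x \<in> {f 0, f 1}" by blast
  then show ?thesis using True assms(1) by (simp add: inj_eq)
qed (use assms(2) in \<open>simp add: attached_def\<close>)

lemma mem_prolong:
  assumes "inj f" "attached f link Q"
  shows "f x \<in> set (prolong f p Q q) \<longleftrightarrow> x \<in> set (walk link p q)"
  using mem_attached[OF assms, of x] assms(1)
  by (auto simp: prolong_def walk_def inj_image_mem_iff)

lemma prolong_ends:
  assumes "attached f link Q" "walk link p q \<noteq> []"
  shows "prolong f p Q q \<noteq> []" "hd (prolong f p Q q) = f (hd (walk link p q))"
    "last (prolong f p Q q) = f (last (walk link p q))"
  using assms
  using assms unfolding attached_def prolong_def walk_def
  by (auto simp: hd_append last_append hd_map last_map split: if_splits)

lemma green_path_prolong: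
  assumes "inj f" "attached f link Q" "green_path h Q" "distinct (walk link p q)"
    and "image_edge f ` set (walk_edges link p q) \<subseteq> color_class h Green"
  shows "green_path h (prolong f p Q q)"
proof -
  let ?P = "\<lambda>x y. {x, y} \<in> color_class h Green"
  have green: "successively ?P (map f xs)" if "set (steps xs) \<subseteq> set (walk_edges link p q)" for xs
  proof -
    have "image_edge f ` set (steps xs) \<subseteq> color_class h Green" using that assms(5) by blast
    then have "\<forall>(x, y) \<in> set (steps xs). {f x, f y} \<in> color_class h Green"
      by (auto simp: image_edge_def image_subset_iff)
    then show ?thesis by (simp add: successively_map successively_iff_steps[of _ xs])
  qed
  have "successively ?P (prolong f p Q q)"
  proof (cases link)
    case True
    then have "successively ?P (map f (p @ [0]))" "successively ?P (map f (1 # q))"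
      by (intro green; simp add: walk_edges_def)+
    then show ?thesis using assms(2,3) True
      by (auto simp: prolong_def green_path_def attached_def successively_append_iff
          successively_Cons)
  next
    case False
    then have "successively ?P (map f (p @ q))" by (intro green) (simp add: walk_edges_def)
    then show ?thesis using assms(2) False by (simp add: prolong_def attached_def)
  qed
  moreover have "distinct (prolong f p Q q)"
  proof -
    have "f x \<notin> set Q" if "x \<in> set p \<union> set q" for x
      using mem_attached[OF assms(1,2), of x] that assms(4) by (auto simp: walk_def)
    moreover have "inj_on f A" for A using assms(1) by (rule inj_on_subset) simp
    ultimately show ?thesis using assms(1,3,4)
      by (auto simp: prolong_def walk_def green_path_def distinct_map inj_eq)
  qed
  ultimately show ?thesis by (simp add: green_path_def)
qed

section \<open>Positions and decision trees\<close>

text \<open>Two letters for the ends 0 and 1 of the green path: \<open>F\<close> for an end that is touched by red and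
  by blue, \<open>C\<close> for an arbitrary one. A final \<open>X\<close> stands for a touched vertex 2 off the path, a
  final \<open>S\<close> or \<open>O\<close> for two such vertices 2 and 3, touched by the same or by opposite colors.\<close>

datatype shape = FFX | FCX | FC | CC | FFS | FFO | START

fun board_of :: "shape \<Rightarrow> board" where
  "board_of FFX = Board [0, 1, 2] [0, 1] [] [(0, 2)]"
| "board_of FCX = Board [0, 2] [0] [] [(0, 2)]"
| "board_of FC = Board [0] [0] [] []"
| "board_of CC = Board [] [] [] [(0, 1)]"
| "board_of FFS = Board [0, 1, 2, 3] [0, 1] [] [(0, 2), (1, 3)]"
| "board_of FFO = Board [0, 1, 2] [0, 1, 3] [] [(0, 2), (1, 3)]"
| "board_of START = Board [] [] [] []"

text \<open>The number \<open>g\<close> counts the edges that the green path lacks for a cycle.\<close>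

definition wins :: "'v set \<Rightarrow> nat \<Rightarrow> shape \<Rightarrow> nat \<Rightarrow> nat \<Rightarrow> bool" where
  "wins V l T g n \<longleftrightarrow> (\<forall>h f c d Q. realizes V h f c d (board_of T) \<longrightarrow> attached f (T \<noteq> START) Q \<longrightarrow>
    green_path h Q \<longrightarrow> length Q + g = Suc l \<longrightarrow> forces V (won V l) n h)"

definition embeds :: "nat list \<Rightarrow> board \<Rightarrow> board \<Rightarrow> bool" where
  "embeds i a b \<longleftrightarrow> distinct i \<and> greens a = [] \<and>
    (\<forall>x \<in> set (reds a). x < length i \<and> i ! x \<in> set (reds b)) \<and>
    (\<forall>x \<in> set (blues a). x < length i \<and> i ! x \<in> set (blues b)) \<and>
    (\<forall>x \<in> set [0..<length i]. \<forall>y \<in> set [0..<length i].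
      undrawn a (x, y) \<longrightarrow> undrawn b (i ! x, i ! y))"

text \<open>A leaf \<open>Close p\<close> closes the cycle through \<open>p\<close>; a leaf \<open>Reduce T p q i\<close> prolongs the green path
  by \<open>p\<close> at 0 and by \<open>q\<close> at 1 and calls the vertices \<open>i\<close> of the new board \<open>0, 1, \<dots>\<close>. All edges
  missing at a leaf are forced to be green. The subtrees of \<open>Play u v\<close> answer red, blue and green;
  \<open>Stop\<close> fills answers that lose at once or that are symmetric to another answer.\<close>

datatype tree =
  Close "nat list"
| Reduce shape "nat list" "nat list" "nat list"
| Play nat nat tree tree tree
| Stop

text \<open>The leaves rely on the promise \<open>W T g n\<close> that Builder wins within \<open>n\<close> rounds from the shape
  \<open>T\<close> if the green path lacks \<open>g\<close> edges.\<close>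

fun valid :: "(shape \<Rightarrow> nat \<Rightarrow> nat \<Rightarrow> bool) \<Rightarrow> bool \<Rightarrow> nat \<Rightarrow> nat \<Rightarrow> board \<Rightarrow> tree \<Rightarrow> bool" where
  "valid W link g n b (Close p) \<longleftrightarrow> link \<and> g = Suc (length p) \<and> distinct (0 # 1 # p) \<and>
    forced_green b (steps (1 # p @ [0])) \<and> missing b (steps (1 # p @ [0])) \<le> n"
| "valid W link g n b (Reduce T p q i) \<longleftrightarrow>
    (let w = walk link p q; es = walk_edges link p q; b' = draw es b; k = length p + length q in
      T \<noteq> START \<and> 0 < k \<and> k \<le> g \<and> distinct w \<and> forced_green b es \<and>
      missing b es \<le> n \<and> W T (g - k) (n - missing b es) \<and>
      take 2 i \<in> {[hd w, last w], [last w, hd w]} \<and> set (drop 2 i) \<inter> set w = {} \<and>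
      (embeds i (board_of T) b' \<or> embeds i (board_of T) (swap_colors b')))"
| "valid W link g n b (Play u v r s t) \<longleftrightarrow> 0 < n \<and> undrawn b (u, v) \<and>
    (hits (u, v) (reds b) \<or> valid W link g (n - 1) (add_red (u, v) b) r) \<and>
    (hits (u, v) (blues b) \<or> set (reds b) \<subseteq> set (blues b) \<and> set (blues b) \<subseteq> set (reds b) \<or>
      valid W link g (n - 1) (add_blue (u, v) b) s) \<and>
    valid W link g (n - 1) (add_green (u, v) b) t"
| "valid W link g n b Stop \<longleftrightarrow> False"

lemma infinite_extend_list:
  fixes vs :: "'v list"
  assumes "infinite V" "finite F" "distinct vs" "set vs \<subseteq> V"
  obtains f where "inj f" "range f \<subseteq> V" "\<And>x. x < length vs \<Longrightarrow> f x = vs ! x"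
    "\<And>x. length vs \<le> x \<Longrightarrow> f x \<notin> F"
proof -
  have "infinite (V - (F \<union> set vs))" using assms(1,2) by simp
  then obtain g :: "nat \<Rightarrow> 'v" where g: "inj g" "range g \<subseteq> V - (F \<union> set vs)"
    using infinite_countable_subset by blast
  let ?f = "\<lambda>x. if x < length vs then vs ! x else g x"
  have fresh: "g x \<in> V" "g x \<notin> F" "g x \<notin> set vs" for x using g(2) by blast+
  show thesis
  proof (rule that)
    show "inj ?f"
      using g(1) assms(3) fresh(3) by (auto simp: inj_def nth_eq_iff_index_eq) (metis nth_mem)+
    show "range ?f \<subseteq> V" using assms(4) fresh(1) nth_mem by (fastforce simp: image_subset_iff)
  qed (use fresh in auto)
qed

lemma realizes_embeds:
  fixes f :: "nat \<Rightarrow> 'v"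
  assumes real: "realizes V h f c d b" and emb: "embeds i a b" and "finite F"
  obtains f' where "realizes V h f' c d a" "\<And>x. x < length i \<Longrightarrow> f' x = f (i ! x)"
    "\<And>x. length i \<le> x \<Longrightarrow> f' x \<notin> F"
proof -
  have f: "inj f" "range f \<subseteq> V" and "edges_in V h" using real by (auto simp: realizes_def)
  have "infinite V" using f finite_subset[OF f(2)] range_inj_infinite by blast
  moreover have "finite (F \<union> \<Union> (fst ` set h))"
    using \<open>finite F\<close> finite_vertices[OF \<open>edges_in V h\<close>] by simp
  moreover have "distinct (map f i)"
    using emb inj_on_subset[OF f(1)] by (simp add: embeds_def distinct_map)
  moreover have "set (map f i) \<subseteq> V" using f(2) by auto
  ultimately obtain f' where f': "inj f'" "range f' \<subseteq> V"
    and old: "\<And>x. x < length i \<Longrightarrow> f' x = f (i ! x)"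
    and fresh: "\<And>x. length i \<le> x \<Longrightarrow> f' x \<notin> F \<union> \<Union> (fst ` set h)"
    by (rule infinite_extend_list) auto
  have "image_edge f' (x, y) \<notin> fst ` set h" if "undrawn a (x, y)" for x y
  proof (cases "x < length i \<and> y < length i")
    case True
    then have "undrawn b (i ! x, i ! y)" using emb that by (simp add: embeds_def)
    then show ?thesis using real True old by (simp add: realizes_def image_edge_def)
  next
    case False
    then have "f' x \<notin> \<Union> (fst ` set h) \<or> f' y \<notin> \<Union> (fst ` set h)"
      using False fresh by (metis UnI2 not_less)
    then show ?thesis by (auto simp: image_edge_def)
  qed
  moreover have "f' ` set (reds a) \<subseteq> touched h c" "f' ` set (blues a) \<subseteq> touched h d"
    using emb real old by (auto simp: embeds_def realizes_def)
  ultimately have "realizes V h f' c d a"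
    using real emb f' by (auto simp: realizes_def embeds_def)
  then show thesis using old fresh by (intro that[of f']) auto
qed

lemma attached_prolong:
  assumes "inj f" "attached f link Q" "w = walk link p q" "w \<noteq> []"
    and ends: "take 2 i \<in> {[hd w, last w], [last w, hd w]}"
    and off: "set (drop 2 i) \<inter> set w = {}"
    and old: "\<And>x. x < length i \<Longrightarrow> f' x = f (i ! x)"
    and fresh: "\<And>x. length i \<le> x \<Longrightarrow> f' x \<notin> set (prolong f p Q q)"
  shows "attached f' True (prolong f p Q q) \<or> attached f' True (rev (prolong f p Q q))"
proof -
  let ?Q = "prolong f p Q q"
  obtain x y js where i: "i = x # y # js"
    using ends by (cases i; cases "tl i") auto
  have new: "f' 0 = f x" "f' 1 = f y" using old[of 0] old[of 1] by (simp_all add: i)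
  have mem: "f z \<in> set ?Q \<longleftrightarrow> z \<in> set w" for z using mem_prolong[OF assms(1,2)] assms(3) by simp
  have "x \<in> set w" "y \<in> set w" using ends assms(4) by (auto simp: i)
  then have ends_mem: "f' 0 \<in> set ?Q" "f' 1 \<in> set ?Q" unfolding new mem by simp_all
  have "f' (Suc (Suc z)) \<notin> set ?Q" for z
  proof (cases "Suc (Suc z) < length i")
    case True
    then have "js ! z \<in> set js" by (simp add: i)
    then have "js ! z \<notin> set w" using off by (auto simp: i)
    then show ?thesis using old[OF True] mem by (simp add: i)
  qed (use fresh in simp)
  then have "z \<in> {0, 1}" if "f' z \<in> set ?Q" for z
    using that by (metis One_nat_def insertCI not0_implies_Suc)
  then have "{z. f' z \<in> set ?Q} = {0, 1}" using ends_mem by blast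
  moreover have "set ?Q \<inter> range f' = f' ` {z. f' z \<in> set ?Q}" by blast
  ultimately have "set ?Q \<inter> range f' = {f' 0, f' 1}" by simp
  moreover have "?Q \<noteq> []" "hd ?Q = f (hd w)" "last ?Q = f (last w)"
    using prolong_ends[OF assms(2)] assms(3,4) by blast+
  moreover have "x = hd w \<and> y = last w \<or> x = last w \<and> y = hd w" using ends by (simp add: i)
  ultimately show ?thesis
    by (elim disjE) (simp_all add: attached_def new hd_rev last_rev del: One_nat_def)
qed

lemma valid_Close_forces:
  assumes "valid W link g n b (Close p)" "realizes V h f c d b" "attached f link Q" "green_path h Q"
    and "length Q + g = Suc l"
  shows "forces V (won V l) n h"
proof -
  let ?es = "steps (1 # p @ [0])"
  have link: "link" and g: "g = Suc (length p)" and "distinct (0 # 1 # p)"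
    and forced: "forced_green b ?es" and time: "missing b ?es \<le> n"
    using assms(1) by simp_all
  have "forces V (won V l) (missing b ?es + (n - missing b ?es)) h"
  proof (rule forces_if_forces_draw[OF assms(2) forced])
    fix h' assume "set h \<subseteq> set h'" and h': "realizes V h' f c d (draw ?es b)"
    have green: "image_edge f ` set ?es \<subseteq> color_class h' Green" and "inj f" "edges_in V h'"
      using h' by (auto simp: realizes_def greens_draw)
    let ?Q = "prolong f [] Q p"
    have es: "?es = steps (1 # p) @ [(last (1 # p), 0)]" using steps_snoc[of "1 # p" 0] by simp
    have "green_path h' ?Q"
    proof (rule green_path_prolong[OF \<open>inj f\<close> assms(3)])
      show "green_path h' Q" using assms(4) \<open>set h \<subseteq> set h'\<close> by (rule green_path_mono)
      show "distinct (walk link [] p)" using link \<open>distinct (0 # 1 # p)\<close> by (simp add: walk_def)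
      show "image_edge f ` set (walk_edges link [] p) \<subseteq> color_class h' Green"
        using green link unfolding es by (auto simp: walk_edges_def steps_def)
    qed
    moreover have "{last ?Q, hd ?Q} \<in> color_class h' Green"
      using prolong_ends[OF assms(3), of "[]" p] green link unfolding es
      by (simp add: walk_def image_edge_def split: if_splits)
    moreover have "length ?Q = l" using assms(5) g by (simp add: prolong_def)
    moreover have "?Q \<noteq> []" using assms(3) link by (simp add: attached_def prolong_def)
    ultimately show "forces V (won V l) (n - missing b ?es) h'"
      using won_if_green_cycle[OF \<open>edges_in V h'\<close>] forces_if_won by metis
  qed
  then show ?thesis using time by simp
qed

lemma valid_Reduce_forces:
  assumes W: "\<And>T k m. 0 < k \<Longrightarrow> k \<le> g \<Longrightarrow> W T (g - k) m \<Longrightarrow> wins V l T (g - k) m"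
    and "valid W link g n b (Reduce T p q i)" "realizes V h f c d b" "attached f link Q"
    and "green_path h Q" "length Q + g = Suc l"
  shows "forces V (won V l) n h"
proof -
  let ?w = "walk link p q" and ?es = "walk_edges link p q" and ?k = "length p + length q"
  let ?b = "draw ?es b"
  have k: "T \<noteq> START" "0 < ?k" "?k \<le> g" and "distinct ?w" and forced: "forced_green b ?es"
    and time: "missing b ?es \<le> n" "W T (g - ?k) (n - missing b ?es)"
    and ends: "take 2 i \<in> {[hd ?w, last ?w], [last ?w, hd ?w]}" "set (drop 2 i) \<inter> set ?w = {}"
    and emb: "embeds i (board_of T) ?b \<or> embeds i (board_of T) (swap_colors ?b)"
    using assms(2) unfolding valid.simps Let_def by blast+
  have "forces V (won V l) (missing b ?es + (n - missing b ?es)) h"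
  proof (rule forces_if_forces_draw[OF assms(3) forced])
    fix h' assume "set h \<subseteq> set h'" and h': "realizes V h' f c d ?b"
    then have green: "image_edge f ` set ?es \<subseteq> color_class h' Green" and "inj f"
      by (auto simp: realizes_def greens_draw)
    let ?Q = "prolong f p Q q"
    obtain c' d' f' where new: "realizes V h' f' c' d' (board_of T)"
      "\<And>x. x < length i \<Longrightarrow> f' x = f (i ! x)" "\<And>x. length i \<le> x \<Longrightarrow> f' x \<notin> set ?Q"
      using emb realizes_embeds[OF h' _ finite_set]
        realizes_embeds[OF realizes_swap_colors[OF h'] _ finite_set]
      by metis
    have "?w \<noteq> []" using k(2) by (auto simp: walk_def)
    with \<open>inj f\<close> assms(4) ends new(2,3)
    have "attached f' True ?Q \<or> attached f' True (rev ?Q)" by (intro attached_prolong[OF _ _ refl])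
    moreover have "green_path h' ?Q"
      using \<open>inj f\<close> assms(4) green_path_mono[OF assms(5) \<open>set h \<subseteq> set h'\<close>] \<open>distinct ?w\<close> green
      by (rule green_path_prolong)
    moreover have "length ?Q + (g - ?k) = Suc l" using assms(6) k(3) by (simp add: prolong_def)
    ultimately obtain Q'
      where "attached f' True Q'" "green_path h' Q'" "length Q' + (g - ?k) = Suc l"
      using green_path_rev length_rev by metis
    then show "forces V (won V l) (n - missing b ?es) h'"
      using W[OF k(2,3) time(2)] k(1) new(1) unfolding wins_def by auto
  qed
  then show ?thesis using time(1) by simp
qed

lemma valid_forces:
  assumes W: "\<And>T k m. 0 < k \<Longrightarrow> k \<le> g \<Longrightarrow> W T (g - k) m \<Longrightarrow> wins V l T (g - k) m"
    and "valid W link g n b t" "realizes V h f c d b" "attached f link Q"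
    and "green_path h Q" "length Q + g = Suc l"
  shows "forces V (won V l) n h"
  using assms(2-)
proof (induction t arbitrary: n b h c d)
  case (Close p)
  then show ?case by (rule valid_Close_forces)
next
  case (Reduce T p q i)
  then show ?case using valid_Reduce_forces[of g W V l, OF W] by blast
next
  case (Play u v r s t)
  obtain m where n: "n = Suc m" using Play.prems(1) by (cases n) auto
  let ?e = "(u, v)"
  have undrawn: "undrawn b ?e" using Play.prems(1) by simp
  have path: "green_path h' Q" if "set h \<subseteq> set h'" for h'
    using Play.prems(4) that by (rule green_path_mono)
  show ?case unfolding n
  proof (rule forces_Suc_if_undrawn[OF Play.prems(2) undrawn])
    fix h' c d
    assume "\<not> hits ?e (reds b)" and h': "set h \<subseteq> set h'" "realizes V h' f c d (add_red ?e b)"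
    then have "valid W link g m (add_red ?e b) r" using Play.prems(1) n by simp
    then show "forces V (won V l) m h'" using h' Play.prems(3,5) path by (intro Play.IH(1))
  next
    fix h'
    assume "\<not> hits ?e (blues b)" "set (reds b) \<noteq> set (blues b)"
      and h': "set h \<subseteq> set h'" "realizes V h' f c d (add_blue ?e b)"
    then have "valid W link g m (add_blue ?e b) s" using Play.prems(1) n by auto
    then show "forces V (won V l) m h'" using h' Play.prems(3,5) path by (intro Play.IH(2))
  next
    fix h'
    assume h': "set h \<subseteq> set h'" "realizes V h' f c d (add_green ?e b)"
    have "valid W link g m (add_green ?e b) t" using Play.prems(1) n by simp
    then show "forces V (won V l) m h'" using h' Play.prems(3,5) path by (intro Play.IH(3))
  qed
qed simp

lemma wins_if_valid:
  assumes "\<And>T k m. 0 < k \<Longrightarrow> k \<le> g \<Longrightarrow> W T (g - k) m \<Longrightarrow> wins V l T (g - k) m"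
    and "valid W (T \<noteq> START) g n (board_of T) t"
  shows "wins V l T g n"
  unfolding wins_def using valid_forces[of g W V l, OF assms] by blast

lemma wins_mono: "wins V l T g n \<Longrightarrow> n \<le> m \<Longrightarrow> wins V l T g m"
  unfolding wins_def by (meson forces_mono)

section \<open>Rounds needed from each shape\<close>

text \<open>Apart from exceptions for small \<open>g\<close>, Builder needs \<open>3 * g / 2\<close> rounds plus a constant that
  depends on the shape. The congruences make the colors of the vertices 2 and 3 match when the cycle
  is closed.\<close>

fun affordable :: "shape \<Rightarrow> nat \<Rightarrow> nat \<Rightarrow> bool" where
  "affordable FFX g n \<longleftrightarrow> 1 \<le> g \<and> 3 * g \<le> 2 * n + 2"
| "affordable FCX g n \<longleftrightarrow> 1 \<le> g \<and> 3 * g \<le> 2 * n \<and> (g = 2 \<longrightarrow> 4 \<le> n)"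
| "affordable FC g n \<longleftrightarrow> 1 \<le> g \<and> 3 * g + 1 \<le> 2 * n \<and> (g = 3 \<longrightarrow> 6 \<le> n)"
| "affordable CC g n \<longleftrightarrow> 4 \<le> g \<and> 3 * g + 2 \<le> 2 * n \<and> (g \<le> 8 \<longrightarrow> 3 * g + 3 \<le> 2 * n)"
| "affordable FFS g n \<longleftrightarrow> 5 \<le> g \<and> g mod 4 = 1 \<and> 3 * g \<le> 2 * n + 3"
| "affordable FFO g n \<longleftrightarrow>
    (g = 3 \<or> 7 \<le> g) \<and> 3 * g \<le> 2 * n + 3 \<and> (g mod 4 \<noteq> 3 \<longrightarrow> 3 * g \<le> 2 * n + 2)"
| "affordable START g n \<longleftrightarrow> 17 \<le> g \<and> 3 * g \<le> 2 * n + 2 \<and> (g mod 4 \<noteq> 0 \<longrightarrow> 3 * g \<le> 2 * n + 1)"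

definition feasible :: "shape \<Rightarrow> nat \<Rightarrow> nat \<Rightarrow> bool" where
  "feasible T g n \<longleftrightarrow> (\<exists>m\<le>n. \<exists>t. valid affordable (T \<noteq> START) g m (board_of T) t)"

lemma feasibleI: "valid affordable (T \<noteq> START) g n (board_of T) t \<Longrightarrow> feasible T g n"
  by (auto simp: feasible_def)

lemma feasible_mono: "feasible T g m \<Longrightarrow> m \<le> n \<Longrightarrow> feasible T g n"
  unfolding feasible_def by (meson order_trans)

lemmas valid_evals = undrawn_def joined_def hits_def embeds_def walk_def walk_edges_def
  steps_def forced_green_def upt_rec numeral_2_eq_2[symmetric]

lemma feasible_FFX_1: "feasible FFX 1 1"
  by (rule feasibleI[where t = "Close []"]) (simp add: valid_evals)

lemma feasible_FFX_2: "feasible FFX 2 2"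
  by (rule feasibleI[where t = "Close [3]"]) (simp add: valid_evals)

lemma feasible_FFX_3: "feasible FFX 3 4"
  by (rule feasibleI[where t = "Play 2 3 Stop (Close [2, 4]) (Close [2, 3])"])
    (simp add: valid_evals)

lemma feasible_FFX_6: "feasible FFX 6 8"
  by (rule feasibleI[where t = "
    Play 3 4
      (Play 2 3 Stop (Close [5, 2, 6, 3, 7])
        (Play 2 4 Stop (Close [3, 2, 5, 4, 6])
          (Play 3 5 Stop (Close [6, 3, 2, 4, 5])
            (Play 4 6 Stop (Close [7, 4, 2, 3, 5]) (Close [5, 3, 2, 4, 6])))))
      (Play 3 5 (Close [6, 3, 2, 4, 5]) Stop
        (Play 4 6 (Close [2, 3, 5, 4, 7]) Stop (Close [5, 3, 2, 4, 6])))
      (Reduce FCX [] [3, 4] [0, 4, 2])"])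
    (simp add: valid_evals)

lemma feasible_FFX: "4 \<le> g \<Longrightarrow> g \<noteq> 6 \<Longrightarrow> 3 * g \<le> 2 * n + 2 \<Longrightarrow> feasible FFX g n"
  by (rule feasibleI[where t = "
    Play 2 3 Stop (Reduce FFX [2, 4] [] [2, 1, 3])
      (Play 2 4 Stop (Reduce FFX [2, 3] [] [2, 1, 4]) (Reduce FC [] [3, 2, 4] [0, 4]))"])
    (simp add: valid_evals; intro conjI impI; linarith)

lemma feasible_FCX_1: "feasible FCX 1 2"
  by (rule feasibleI[where t = "Close []"]) (simp add: valid_evals)

lemma feasible_FCX_2: "feasible FCX 2 4"
  by (rule feasibleI[where t = "
    Play 1 3 (Play 1 4 Stop (Close [5]) (Close [4])) (Play 1 4 (Close [5]) Stop (Close [4]))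
      (Close [3])"])
    (simp add: valid_evals)

lemma feasible_FCX_3: "feasible FCX 3 5"
  by (rule feasibleI[where t = "
    Play 3 4 (Play 1 3 Stop (Close [2, 3]) (Play 3 5 Stop (Close [3, 6]) (Close [3, 5])))
      (Play 1 5 (Close [3, 5]) (Close [2, 3]) (Play 3 5 (Close [5, 4]) Stop (Close [5, 3])))
      (Play 1 2 Stop (Play 1 3 (Close [4, 3]) Stop (Close [3, 4]))
        (Play 2 3 Stop (Close [2, 5]) (Close [2, 3])))"])
    (simp add: valid_evals)

lemma feasible_FCX_4: "feasible FCX 4 6"
  by (rule feasibleI[where t = "
    Play 1 2 Stop (Play 1 3 (Close [4, 2, 5]) Stop (Close [3, 2, 4]))
      (Play 2 3 Stop (Play 3 4 (Close [2, 5, 3]) Stop (Close [2, 4, 3]))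
        (Reduce FC [] [2, 3] [0, 3]))"])
    (simp add: valid_evals)

lemma feasible_FCX_5: "feasible FCX 5 8"
  by (rule feasibleI[where t = "
    Play 1 3
      (Play 1 4 Stop (Play 2 5 Stop (Close [2, 4, 3, 5]) (Close [5, 2, 4, 3]))
        (Reduce FCX [] [4] [0, 4, 2]))
      (Play 3 4 (Reduce FFX [] [2, 3] [3, 0, 4]) Stop (Reduce FC [] [2, 3, 4] [0, 4]))
      (Reduce FCX [] [3] [0, 3, 2])"])
    (simp add: valid_evals)

lemma feasible_FCX_6: "feasible FCX 6 9"
  by (rule feasibleI[where t = "
    Play 1 3
      (Play 1 4 Stop
        (Play 2 5 Stop (Close [6, 2, 4, 3, 5])
          (Play 3 6 Stop (Close [7, 3, 4, 2, 5]) (Close [5, 2, 4, 3, 6])))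
        (Play 3 4 Stop (Play 2 5 Stop (Close [4, 2, 6, 3, 7]) (Close [4, 2, 5, 3, 6]))
          (Reduce FCX [] [4, 3] [0, 3, 2])))
      (Play 1 4
        (Play 2 5 Stop (Close [6, 2, 3, 4, 5])
          (Play 4 6 Stop (Close [7, 4, 3, 2, 5]) (Close [5, 2, 3, 4, 6]))) Stop
        (Play 3 4 (Play 4 5 Stop (Close [4, 2, 5, 3, 6]) (Reduce FFX [] [4, 5, 3] [0, 3, 2])) Stop
          (Reduce FCX [] [4, 3] [0, 3, 2])))
      (Reduce FCX [] [3] [0, 3, 2])"])
    (simp add: valid_evals)

lemma feasible_FCX_8: "feasible FCX 8 12"
  by (rule feasibleI[where t = "
    Play 2 3 Stop (Reduce FCX [2, 4] [] [2, 1, 3])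
      (Play 2 4 Stop (Reduce FCX [] [2, 3] [0, 3, 4]) (Reduce CC [4, 2, 3] [] [4, 1]))"])
    (simp add: valid_evals)

lemma feasible_FCX: "7 \<le> g \<Longrightarrow> g \<noteq> 8 \<Longrightarrow> 3 * g \<le> 2 * n \<Longrightarrow> feasible FCX g n"
  by (rule feasibleI[where t = "
    Play 1 2 Stop
      (Play 1 3
        (Play 3 4 Stop (Reduce FFX [] [5, 2, 6, 3] [3, 0, 4])
          (Play 3 5 Stop (Reduce FFX [] [6, 2, 4, 3] [3, 0, 5])
            (Reduce FC [] [6, 2, 4, 3, 5] [0, 5]))) Stop
        (Reduce FC [2, 4] [3] [2, 3]))
      (Play 2 3 Stop
        (Play 3 4 (Reduce FFX [] [2, 5, 3] [3, 0, 4]) Stop (Reduce FC [] [2, 4, 3] [0, 3]))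
        (Reduce FC [] [2, 3] [0, 3]))"])
    (simp add: valid_evals; intro conjI impI; linarith)

lemma feasible_FC_1: "feasible FC 1 2"
  by (rule feasibleI[where t = "Close []"]) (simp add: valid_evals)

lemma feasible_FC_2: "feasible FC 2 4"
  by (rule feasibleI[where t = "
    Play 1 2 (Play 1 3 Stop (Close [4]) (Close [3])) Stop (Close [2])"])
    (simp add: valid_evals)

lemma feasible_FC_3: "feasible FC 3 6"
  by (rule feasibleI[where t = "
    Play 1 2
      (Play 1 3 Stop (Play 2 4 Stop (Close [5, 2]) (Close [4, 2]))
        (Reduce FCX [] [3] [0, 3, 2])) Stop
      (Reduce FC [] [2] [0, 2])"])
    (simp add: valid_evals)

lemma feasible_FC_4: "feasible FC 4 7"
  by (rule feasibleI[where t = "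
    Play 1 2
      (Play 1 3 Stop (Play 2 4 Stop (Close [5, 2, 6]) (Close [4, 2, 3]))
        (Reduce FCX [] [3] [0, 3, 2])) Stop
      (Reduce FC [] [2] [0, 2])"])
    (simp add: valid_evals)

lemma feasible_FC_5: "feasible FC 5 8"
  by (rule feasibleI[where t = "
    Play 1 2
      (Play 2 3 Stop (Play 3 4 (Close [3, 5, 2, 6]) Stop (Close [3, 4, 2, 5]))
        (Play 1 4 Stop (Play 4 5 (Close [3, 2, 4, 6]) Stop (Close [3, 2, 4, 5]))
          (Play 2 4 Stop (Play 3 4 (Close [4, 5, 2, 3]) Stop (Close [4, 3, 2, 5]))
            (Reduce FC [] [4, 2, 3] [0, 3])))) Stop
      (Reduce FC [] [2] [0, 2])"])
    (simp add: valid_evals)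

lemma feasible_FC_7: "feasible FC 7 11"
  by (rule feasibleI[where t = "
    Play 2 3
      (Play 1 2 Stop
        (Play 1 4
          (Play 3 5 Stop (Close [6, 2, 7, 3, 4, 5]) (Reduce FFX [] [3, 5, 2] [0, 2, 4])) Stop
          (Reduce FFX [] [4, 2] [2, 0, 3]))
        (Play 2 4 Stop (Reduce FFX [] [2] [2, 0, 3]) (Reduce FCX [] [2, 4] [0, 4, 3]))) Stop
      (Reduce CC [3, 2] [] [3, 1])"])
    (simp add: valid_evals)

lemma feasible_FC: "g = 6 \<or> 8 \<le> g \<Longrightarrow> 3 * g + 1 \<le> 2 * n \<Longrightarrow> feasible FC g n"
  by (rule feasibleI[where t = "
    Play 2 3
      (Play 1 2 Stop
        (Play 3 4 Stop (Reduce FFX [] [3, 5, 2] [0, 2, 4]) (Reduce FC [2, 5] [3, 4] [2, 4]))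
        (Play 2 4 Stop (Reduce FFX [] [2] [2, 0, 3]) (Reduce FCX [] [2, 4] [0, 4, 3]))) Stop
      (Play 1 4
        (Play 1 2 Stop
          (Play 4 5 Stop (Reduce FFX [] [3, 2, 4] [4, 0, 5]) (Reduce FC [] [3, 2, 4, 5] [0, 5]))
          (Reduce FCX [] [2, 3] [0, 3, 4])) Stop
        (Play 4 5
          (Play 2 4 Stop (Reduce FCX [] [4, 3, 2] [0, 2, 5])
            (Reduce FCX [] [4, 2, 3] [0, 3, 5])) Stop
          (Reduce FC [] [4, 5] [0, 5])))"])
    (simp add: valid_evals; intro conjI impI; linarith)

lemma feasible_CC_4: "feasible CC 4 8"
  by (rule feasibleI[where t = "
    Play 2 3
      (Play 0 2 Stop (Play 3 4 Stop (Close [2, 5, 3]) (Close [2, 4, 3]))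
        (Play 2 4 Stop (Reduce FCX [2] [] [2, 1, 3])
          (Play 1 3 Stop (Close [2, 4, 3])
            (Play 3 4 Stop (Play 2 5 Stop (Close [3, 6, 2]) (Close [3, 5, 2]))
              (Close [3, 4, 2]))))) Stop
      (Play 0 4
        (Play 0 2 Stop
          (Play 1 2 (Play 1 3 Stop (Close [5, 2, 3]) (Close [3, 2, 5])) Stop
            (Reduce FCX [] [2, 3] [0, 3, 4]))
          (Play 1 4 Stop (Play 1 3 (Close [5, 4, 2]) Stop (Close [3, 4, 2]))
            (Play 3 4 Stop (Close [4, 2, 3]) (Close [4, 3, 2])))) Stop
        (Play 1 2
          (Play 2 4 Stop (Play 4 5 (Close [4, 3, 2]) Stop (Close [4, 5, 2]))
            (Play 1 3 Stop (Play 2 5 Stop (Close [6, 2, 4]) (Close [5, 2, 4]))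
              (Close [3, 2, 4]))) Stop
          (Play 3 4
            (Play 2 4 Stop (Play 2 5 (Close [2, 6, 4]) Stop (Close [2, 5, 4]))
              (Play 1 3 Stop (Close [4, 2, 3]) (Close [3, 2, 4]))) Stop
            (Close [2, 3, 4]))))"])
    (simp add: valid_evals)

lemma feasible_CC_5: "feasible CC 5 9"
  by (rule feasibleI[where t = "
    Play 0 2
      (Play 2 3 Stop
        (Play 3 4 (Play 0 4 Stop (Close [2, 5, 3, 6]) (Close [3, 5, 2, 4])) Stop
          (Reduce FC [4, 3] [2] [2, 4]))
        (Play 2 4 Stop
          (Play 3 4 (Play 0 3 Stop (Close [2, 3, 5, 4]) (Close [4, 5, 2, 3])) Stop
            (Reduce FC [2, 3, 4] [] [2, 1]))
          (Play 3 5
            (Play 1 5 Stop (Close [3, 2, 4, 5])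
              (Play 4 5 Stop (Close [5, 2, 3, 4])
                (Play 0 3 Stop (Close [3, 2, 4, 5]) (Close [5, 4, 2, 3]))))
            (Play 1 3 (Close [5, 2, 4, 3]) Stop
              (Play 3 4 (Close [3, 2, 4, 5]) Stop (Close [3, 4, 2, 5])))
            (Play 1 4
              (Play 1 5 Stop (Close [3, 2, 4, 5])
                (Play 0 4 Stop (Close [5, 4, 2, 3]) (Close [5, 3, 2, 4])))
              (Play 1 5 (Close [2, 3, 5, 4]) Stop (Close [5, 3, 2, 4]))
              (Play 0 5 Stop (Close [4, 2, 5, 3]) (Close [4, 2, 3, 5])))))) Stop
      (Reduce CC [2] [] [2, 1])"])
    (simp add: valid_evals)

lemma feasible_CC_6: "feasible CC 6 11"
  by (rule feasibleI[where t = "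
    Play 0 2
      (Play 0 3 Stop
        (Play 1 4 (Reduce FCX [] [3, 4] [0, 4, 2]) (Reduce FCX [] [2, 4] [0, 4, 3])
          (Reduce FCX [] [4] [0, 4, 2]))
        (Reduce CC [3] [] [3, 1])) Stop
      (Reduce CC [2] [] [2, 1])"])
    (simp add: valid_evals)

lemma feasible_CC_7: "feasible CC 7 12"
  by (rule feasibleI[where t = "
    Play 0 2
      (Play 0 3 Stop
        (Play 1 4
          (Play 4 5 Stop (Reduce FFX [] [3, 2, 4] [4, 0, 5]) (Reduce FCX [] [3, 4, 5] [0, 5, 2]))
          (Play 4 5 (Reduce FFX [] [2, 3, 4] [4, 0, 5]) Stop (Reduce FCX [] [2, 4, 5] [0, 5, 3]))
          (Reduce FCX [] [4] [0, 4, 2]))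
        (Play 1 2 Stop
          (Play 1 4 (Reduce FCX [3] [5, 2] [2, 3, 4]) Stop (Reduce FC [3] [4, 2] [2, 3]))
          (Reduce CC [3] [2] [3, 2]))) Stop
      (Reduce CC [2] [] [2, 1])"])
    (simp add: valid_evals)

lemma feasible_CC_8: "feasible CC 8 14"
  by (rule feasibleI[where t = "
    Play 0 2
      (Play 0 3 Stop
        (Play 2 4 Stop
          (Play 1 3 (Reduce FFX [3, 5] [2] [2, 3, 4]) Stop (Reduce FCX [2, 5] [3] [2, 3, 4]))
          (Play 3 5 (Reduce FCX [] [3, 2, 4] [0, 4, 5]) Stop (Reduce CC [5, 3, 2, 4] [] [5, 1])))
        (Play 1 2 Stop
          (Play 1 4 (Reduce FCX [3] [5, 2] [2, 3, 4]) Stop (Reduce FC [3] [4, 2] [2, 3]))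
          (Reduce CC [3] [2] [3, 2]))) Stop
      (Reduce CC [2] [] [2, 1])"])
    (simp add: valid_evals)

lemma feasible_CC: "9 \<le> g \<Longrightarrow> 3 * g + 2 \<le> 2 * n \<Longrightarrow> feasible CC g n"
  by (rule feasibleI[where t = "
    Play 2 3
      (Play 2 4 Stop
        (Play 3 5 Stop
          (Play 0 4 (Reduce FFX [3, 6, 2] [4] [3, 4, 5]) Stop (Reduce FCX [4] [2, 6, 3] [3, 4, 5]))
          (Play 4 6 (Reduce FCX [] [2, 5, 3, 4] [4, 0, 6]) Stop
            (Reduce CC [] [2, 5, 3, 4, 6] [0, 6])))
        (Play 0 3 Stop (Reduce FC [4, 2] [3] [3, 4])
          (Play 2 5 Stop
            (Play 5 6 (Reduce FCX [3] [2, 4, 5] [5, 3, 6]) Stop (Reduce CC [6, 5, 3] [2, 4] [6, 4]))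
            (Play 3 4 Stop
              (Play 4 6 (Reduce FCX [3] [4, 2, 5] [3, 5, 6]) Stop
                (Reduce CC [6, 4, 2, 5, 3] [] [6, 1]))
              (Reduce CC [5, 2, 4, 3] [] [5, 1]))))) Stop
      (Play 0 4
        (Play 2 4 Stop (Reduce FC [3, 2] [4] [4, 3])
          (Play 0 5 Stop
            (Play 5 6 (Reduce FCX [] [5, 4, 2, 3] [0, 3, 6]) Stop
              (Reduce CC [6, 5, 4, 2, 3] [] [6, 1]))
            (Play 1 4 Stop
              (Play 1 6 (Reduce FCX [5] [3, 2, 4] [4, 5, 6]) Stop
                (Reduce CC [5] [6, 4, 2, 3] [5, 3]))
              (Reduce CC [5] [4, 2, 3] [5, 3])))) Stop
        (Play 1 2
          (Play 1 5 Stop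
            (Play 5 6 (Reduce FCX [4] [3, 2, 5] [5, 4, 6]) Stop (Reduce CC [4] [3, 2, 5, 6] [4, 6]))
            (Play 2 4 Stop
              (Play 4 6 (Reduce FCX [4] [5, 2, 3] [4, 3, 6]) Stop
                (Reduce CC [6, 4] [5, 2, 3] [6, 3]))
              (Reduce CC [3, 2, 4] [5] [3, 5]))) Stop
          (Reduce CC [4] [2, 3] [4, 3])))"])
    (simp add: valid_evals; intro conjI impI; linarith)

lemma feasible_FFS_5: "feasible FFS 5 6"
  by (rule feasibleI[where t = "
    Play 2 3 Stop (Close [2, 4, 3, 5])
      (Play 2 4 Stop (Close [5, 2, 3, 4])
        (Play 3 5 Stop (Close [6, 3, 2, 4]) (Close [4, 2, 3, 5])))"])
    (simp add: valid_evals)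

lemma feasible_FFS_1_mod_4: "6 * k + 12 \<le> n \<Longrightarrow> feasible FFS (4 * k + 9) n"
  by (rule feasibleI[where t = "
    Play 2 4 Stop (Reduce FFO [2, 5] [] [2, 1, 4, 3])
      (Play 2 5 Stop (Reduce FFO [2, 4] [] [2, 1, 5, 3]) (Reduce FCX [] [4, 2, 5] [0, 5, 3]))"])
    (simp add: valid_evals; intro conjI impI; linarith)

lemma feasible_FFO_3: "feasible FFO 3 3"
  by (rule feasibleI[where t = "Close [2, 3]"]) (simp add: valid_evals)

lemma feasible_FFO_3_mod_4: "6 * k + 9 \<le> n \<Longrightarrow> feasible FFO (4 * k + 7) n"
  by (rule feasibleI[where t = "
    Play 2 4 Stop (Reduce FFS [2, 5] [] [2, 1, 4, 3])
      (Play 2 5 Stop (Reduce FFS [2, 4] [] [2, 1, 5, 3]) (Reduce FCX [] [4, 2, 5] [0, 5, 3]))"])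
    (simp add: valid_evals; intro conjI impI; linarith)

lemma feasible_FFO: "7 \<le> g \<Longrightarrow> 3 * g \<le> 2 * n + 2 \<Longrightarrow> feasible FFO g n"
  by (rule feasibleI[where t = "
    Play 2 4 Stop (Reduce FFX [2, 5] [] [2, 1, 4])
      (Play 2 5 Stop (Reduce FFX [2, 4] [] [2, 1, 5]) (Reduce FC [] [4, 2, 5] [0, 5]))"])
    (simp add: valid_evals; intro conjI impI; linarith)

lemma feasible_START:
  assumes "17 \<le> g" "3 * g \<le> 2 * n + 2" "affordable FFO (g - 5) (n - 8)"
  shows "feasible START g n"
  by (rule feasibleI[where t = "
    Play 0 1
      (Play 0 2 Stop
        (Play 1 3 Stop
          (Play 2 4 (Reduce FFO [] [1, 5, 0, 6, 2] [1, 2, 3, 4]) Stop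
            (Play 2 5 (Reduce FFO [] [1, 6, 0, 4, 2] [1, 2, 3, 5]) Stop
              (Reduce FCX [] [0, 6, 1, 4, 2, 5] [0, 5, 3])))
          (Play 2 4
            (Play 1 5 Stop (Reduce FFO [] [1, 3, 0, 6, 2] [1, 2, 5, 4])
              (Reduce FCX [] [0, 6, 2, 3, 1, 5] [0, 5, 4])) Stop
            (Reduce FC [] [0, 3, 1, 2, 4] [0, 4])))
        (Play 0 3 Stop
          (Play 1 4 Stop
            (Play 3 5 (Reduce FFO [] [1, 6, 0, 2, 3] [1, 3, 4, 5]) Stop
              (Play 3 6 (Reduce FFO [] [1, 2, 0, 5, 3] [1, 3, 4, 6]) Stop
                (Reduce FCX [] [0, 2, 1, 5, 3, 6] [0, 6, 4])))
            (Play 3 5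
              (Play 1 6 Stop (Reduce FFO [] [1, 4, 0, 2, 3] [1, 3, 6, 5])
                (Reduce FCX [] [0, 2, 3, 4, 1, 6] [0, 6, 5])) Stop
              (Reduce CC [] [2, 0, 4, 1, 3, 5] [2, 5])))
          (Play 1 2 Stop
            (Play 2 4
              (Play 4 5 Stop (Reduce FFX [] [1, 6, 2, 0, 3, 4] [4, 1, 5])
                (Play 4 6 Stop (Reduce FFX [] [1, 3, 0, 2, 5, 4] [4, 1, 6])
                  (Reduce FC [] [1, 3, 0, 2, 5, 4, 6] [1, 6]))) Stop
              (Reduce FC [] [1, 3, 0, 2, 4] [1, 4]))
            (Reduce CC [] [1, 2, 0, 3] [1, 3])))) Stop
      (Reduce CC [] [0, 1] [0, 1])"])
    (use assms in \<open>simp add: valid_evals del: affordable.simps(6); intro conjI impI; linarith\<close>)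

lemma feasible_FFX_if_affordable:
  assumes "affordable FFX g n"
  shows "feasible FFX g n"
proof -
  note small = feasible_FFX_1 feasible_FFX_2 feasible_FFX_3 feasible_FFX_6
  consider "g = 1" | "g = 2" | "g = 3" | "g = 6" | "4 \<le> g" "g \<noteq> 6" using assms by force
  then show ?thesis
    by cases
      (use assms in \<open>auto intro: small[THEN feasible_mono] feasible_FFX simp del: One_nat_def\<close>)
qed

lemma feasible_FCX_if_affordable:
  assumes "affordable FCX g n"
  shows "feasible FCX g n"
proof -
  note small = feasible_FCX_1 feasible_FCX_2 feasible_FCX_3 feasible_FCX_4 feasible_FCX_5
    feasible_FCX_6 feasible_FCX_8
  consider "g = 1" | "g = 2" | "g = 3" | "g = 4" | "g = 5" | "g = 6" | "g = 8" | "7 \<le> g" "g \<noteq> 8"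
    using assms by force
  then show ?thesis
    by cases
      (use assms in \<open>auto intro: small[THEN feasible_mono] feasible_FCX simp del: One_nat_def\<close>)
qed

lemma feasible_FC_if_affordable:
  assumes "affordable FC g n"
  shows "feasible FC g n"
proof -
  note small = feasible_FC_1 feasible_FC_2 feasible_FC_3 feasible_FC_4 feasible_FC_5 feasible_FC_7
  consider "g = 1" | "g = 2" | "g = 3" | "g = 4" | "g = 5" | "g = 7" | "g = 6 \<or> 8 \<le> g"
    using assms by force
  then show ?thesis
    by cases
      (use assms in \<open>auto intro: small[THEN feasible_mono] feasible_FC simp del: One_nat_def\<close>)
qed

lemma feasible_CC_if_affordable:
  assumes "affordable CC g n"
  shows "feasible CC g n"
proof -
  note small = feasible_CC_4 feasible_CC_5 feasible_CC_6 feasible_CC_7 feasible_CC_8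
  consider "g = 4" | "g = 5" | "g = 6" | "g = 7" | "g = 8" | "9 \<le> g" using assms by force
  then show ?thesis
    by cases (use assms in \<open>auto intro: small[THEN feasible_mono] feasible_CC\<close>)
qed

lemma feasible_FFS_if_affordable:
  assumes "affordable FFS g n"
  shows "feasible FFS g n"
proof -
  have "\<exists>k. g = 5 \<or> g = 4 * k + 9" using assms by simp presburger
  then consider "g = 5" | k where "g = 4 * k + 9" by blast
  then show ?thesis
    by cases (use assms in \<open>auto intro: feasible_mono[OF feasible_FFS_5] feasible_FFS_1_mod_4\<close>)
qed

lemma feasible_FFO_if_affordable:
  assumes "affordable FFO g n"
  shows "feasible FFO g n"
proof -
  have "\<exists>k. g = 3 \<or> g = 4 * k + 7 \<or> g mod 4 \<noteq> 3" by presburger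
  then consider "g = 3" | k where "g = 4 * k + 7" | "g \<noteq> 3" "g mod 4 \<noteq> 3" by blast
  then show ?thesis
    by cases (use assms in \<open>auto intro: feasible_mono[OF feasible_FFO_3] feasible_FFO_3_mod_4
      feasible_FFO\<close>)
qed

lemma feasible_START_if_affordable:
  assumes "affordable START g n"
  shows "feasible START g n"
proof (rule feasible_START)
  have "j mod 4 = 3 \<longleftrightarrow> (j + 5) mod 4 = 0" for j :: nat by presburger
  from this[of "g - 5"] show "affordable FFO (g - 5) (n - 8)" using assms by auto
qed (use assms in auto)

lemma feasible_if_affordable:
  assumes "affordable T g n"
  shows "feasible T g n"
  using assms
  by (cases T) (simp_all only: feasible_FFX_if_affordable feasible_FCX_if_affordable
      feasible_FC_if_affordable feasible_CC_if_affordable feasible_FFS_if_affordable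
      feasible_FFO_if_affordable feasible_START_if_affordable)

lemma wins_if_affordable:
  assumes "affordable T g n"
  shows "wins V l T g n"
  using assms
proof (induction g arbitrary: T n rule: less_induct)
  case (less g)
  then obtain m t where "m \<le> n" and t: "valid affordable (T \<noteq> START) g m (board_of T) t"
    using feasible_if_affordable[of T g n] unfolding feasible_def by blast
  have "wins V l T g m"
  proof (rule wins_if_valid[OF _ t])
    show "wins V l T' (g - k) m'" if "0 < k" "k \<le> g" "affordable T' (g - k) m'" for T' k m'
      using that by (intro less.IH) auto
  qed
  then show ?case using \<open>m \<le> n\<close> by (rule wins_mono)
qed

section \<open>The value of the game\<close>

lemma online_ramsey_upper_bound:
  fixes V :: "'v set"
  assumes "infinite V" "16 \<le> l"
  shows "online_ramsey V (path_graph 3) (path_graph 3) (cycle_graph l) \<le> enat (optimal_rounds l)"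
proof (rule online_ramsey_le[OF assms(1)])
  obtain f :: "nat \<Rightarrow> 'v" where "inj f" "range f \<subseteq> V"
    using infinite_countable_subset[OF assms(1)] by blast
  then have "realizes V [] f Red Blue (board_of START)" by (simp add: realizes_def)
  moreover have "attached f (START \<noteq> START) []" "green_path [] []"
    by (simp_all add: attached_def green_path_def)
  moreover have "wins V l START (Suc l) (optimal_rounds l)"
  proof (rule wins_if_affordable)
    have "3 * Suc l \<le> 2 * optimal_rounds l + 2"
      "Suc l mod 4 \<noteq> 0 \<Longrightarrow> 3 * Suc l \<le> 2 * optimal_rounds l + 1"
      unfolding optimal_rounds_def by presburger+
    then show "affordable START (Suc l) (optimal_rounds l)" using assms(2) by simp
  qed
  ultimately show "forces V (won V l) (optimal_rounds l) []" unfolding wins_def by auto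
qed

theorem theorem1p2:
  fixes V :: "'v set" and l :: nat
  assumes "infinite V" and "l \<ge> 16"
  shows "online_ramsey V (path_graph 3) (path_graph 3) (cycle_graph l) =
    enat (if l mod 4 = 3 then (3 * l + 1) div 2 else (3 * (l + 1)) div 2)"
  unfolding optimal_rounds_def[symmetric]
proof (rule antisym)
  show "online_ramsey V (path_graph 3) (path_graph 3) (cycle_graph l) \<le> enat (optimal_rounds l)"
    using assms by (rule online_ramsey_upper_bound)
  show "enat (optimal_rounds l) \<le> online_ramsey V (path_graph 3) (path_graph 3) (cycle_graph l)"
    using assms(2) by (intro online_ramsey_lower_bound) simp
qed

end
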